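(* (i) Suppose there exist $\lambda>0$, free of $\mathbf u$ and $p$, and $\mathbf u_p^*\in[-1,1]^p$ such that for all $\mathbf u\in[-1,1]^p$ we have $$\mathbb P\Big[M_p(\mathbf u_p^* )-M_p(\mathbf u)\ge\lambda\|\mathbf u-\mathbf u_p^*\|_2^2\ \Big|\ \mathbf X\Big]=1-o(1).\qquad(\ast)$$ Then the following separation condition holds: for all $\varepsilon>0$ there exists $\delta'>0$ such that $$\mathbb P\Big[\sup_{\mathbf u\in[-1,1]^p:\ \|\mathbf u-\mathbf u_p^*\|_2^2>p\varepsilon}\frac1p\{M_p(\mathbf u)-M_p(\mathbf u_p^* )\}<-\delta'\ \Big|\ \mathbf X\Big]=1-o(1).$$ (ii) In particular, $(\ast)$ holds under either of the following conditions: (a) $\displaystyle\limsup_{p\to\infty}\sup_{1\le i\le p}\sum_{j\ne i}|A_p(i,j)|<\sigma^2$; (b) the prior $\pi$ has a density with respect to Lebesgue measure on $[-1,1]$ of the form $\frac{d\pi}{dx}=\frac1Z\exp(-V(x))$ ($Z$ a normalizing constant), where $V$ is even, $V:[0,1]\to\mathbb R$ is increasing, and $V'$ is convex on $[0,1)$; and further $\liminf_{p\to\infty}\lambda_{\min}(\mathbf X^{\mathrm T}\mathbf X)>0$.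
   Context: Fix $\sigma^2>0$ and a probability measure $\pi$ on $[-1,1]$ whose support contains both $-1$ and $1$. For $\gamma=(\gamma_1,\gamma_2)\in\mathbb R^2$ let $c(\gamma)=\log\int_{[-1,1]}e^{\gamma_1z-\gamma_2z^2/2}\,d\pi(z)$ and $\frac{d\pi_\gamma}{d\pi}(z)=\exp(\gamma_1z-\frac{\gamma_2}2z^2-c(\gamma))$. Write $\dot c=\partial c/\partial\gamma_1$; for $t\in(-1,1)$, $h(t,\gamma_2)$ is the unique real with $\dot c(h(t,\gamma_2),\gamma_2)=t$. Let $\pi_{\pm\infty}$ be the point mass at $\pm1$. Define $G:[-1,1]\times\mathbb R\to[0,\infty]$ by $G(u,d)=u\,h(u,d)-c(h(u,d),d)+c(0,d)$ for $u\in(-1,1)$ and $G(\pm1,d)=\mathrm{D_{KL}}(\pi_{\pm\infty}\|\pi_{(0,d)})$. Asymptotics: $p\to\infty$, $n=n(p)\to\infty$; $\mathbf X\in\mathbb R^{n\times p}$ is a sequence of design matrices (conditioned on), and $\mathbf y\sim N(\mathbf X\boldsymbol\beta_0,\sigma^2\mathbf I)$ with $\boldsymbol\beta_0\in\mathbb R^p$. $A_p$ and $D_p$ are the off-diagonal and diagonal parts of $\mathbf X^{\mathrm T}\mathbf X$; $d_i=D_p(i,i)/\sigma^2$; $\mathbf z=\mathbf X^{\mathrm T}\mathbf y$. For $\mathbf u\in[-1,1]^p$, $M_p(\mathbf u)=-\frac1{2\sigma^2}[\mathbf u^{\mathrm T}A_p\mathbf u-2\mathbf z^{\mathrm T}\mathbf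 u]-\sum_{i=1}^pG(u_i,d_i)$. $\lambda_{\min}$ denotes the smallest eigenvalue.
   Formalization: In (∗) "for all u" is read inside the probability (one event for all u), and u*_p is a measurable random point that may depend on y; with the quantifier outside, (i) fails for random u* and (ii) for fixed u*. In (b), V'(0) is the two-sided derivative of the even function V. *)

theory Defs
  imports "HOL-Probability.Probability" "Jordan_Normal_Form.Char_Poly"
begin

unbundle no vec_syntax
unbundle no inner_syntax

definition msupport :: "'a::topological_space measure \<Rightarrow> 'a set" where
  "msupport P = {x. \<forall>U. open U \<longrightarrow> x \<in> U \<longrightarrow> 0 < emeasure P U}"

(* A measure on [-1,1] is represented by a Borel measure on the real line that is concentrated
   on [-1,1]. *)

definition log_mgf :: "real measure \<Rightarrow> real \<Rightarrow> real \<Rightarrow> real" where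
  "log_mgf \<pi> g1 g2 = ln (LINT z:{-1..1}|\<pi>. exp (g1 * z - g2 * z\<^sup>2 / 2))"

definition tilted :: "real measure \<Rightarrow> real \<Rightarrow> real \<Rightarrow> real measure" where
  "tilted \<pi> g1 g2 = density \<pi> (\<lambda>z. ennreal (exp (g1 * z - g2 / 2 * z\<^sup>2 - log_mgf \<pi> g1 g2)))"

definition log_mgf_dot :: "real measure \<Rightarrow> real \<Rightarrow> real \<Rightarrow> real" where
  "log_mgf_dot \<pi> g1 g2 = deriv (\<lambda>s. log_mgf \<pi> s g2) g1"

definition tilt_inv :: "real measure \<Rightarrow> real \<Rightarrow> real \<Rightarrow> real" where
  "tilt_inv \<pi> t g2 = (THE s. log_mgf_dot \<pi> s g2 = t)"

(* D(P || Q) with values in [0,\<infinity>].  The library's KL_divergence has the reference measure as its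
   first measure argument and is real-valued, so the infinite case is added here: the negative part
   of the log-density is always P-integrable, hence non-integrability means D(P || Q) = \<infinity>. *)
definition KL_ext :: "'a measure \<Rightarrow> 'a measure \<Rightarrow> ereal" where
  "KL_ext P Q =
     (if absolutely_continuous Q P \<and> integrable P (entropy_density (exp 1) Q P)
      then ereal (KL_divergence (exp 1) Q P) else \<infinity>)"

(* Only used for u in [-1,1]; at u = 1 and u = -1 the first argument of KL_ext is the point mass
   at u. *)
definition rate_G :: "real measure \<Rightarrow> real \<Rightarrow> real \<Rightarrow> ereal" where
  "rate_G \<pi> u d =
     (if \<bar>u\<bar> = 1 then KL_ext (return borel u) (tilted \<pi> 0 d)
      else ereal (u * tilt_inv \<pi> u d - log_mgf \<pi> (tilt_inv \<pi> u d) d + log_mgf \<pi> 0 d))"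

definition off_diag :: "real mat \<Rightarrow> real mat" where
  "off_diag B = mat (dim_row B) (dim_col B) (\<lambda>(i, j). if i = j then 0 else B $$ (i, j))"

definition gram :: "real mat \<Rightarrow> real mat" where
  "gram X = transpose_mat X * X"

(* Meant for symmetric matrices of positive dimension, which have a real eigenvalue. *)
definition lambda_min :: "real mat \<Rightarrow> real" where
  "lambda_min B = Min {k. eigenvalue B k}"

definition cube :: "nat \<Rightarrow> real vec set" where
  "cube p = {u \<in> carrier_vec p. \<forall>i<p. u $ i \<in> {-1..1}}"

definition sq_dist :: "real vec \<Rightarrow> real vec \<Rightarrow> real" where
  "sq_dist u v = (u - v) \<bullet> (u - v)"

(* The functional M_p of the response y; its values lie in [-\<infinity>,\<infinity>) as rate_G may be \<infinity> at the
   endpoints. *)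
definition mf_obj :: "real \<Rightarrow> real measure \<Rightarrow> real mat \<Rightarrow> real vec \<Rightarrow> real vec \<Rightarrow> ereal" where
  "mf_obj \<sigma> \<pi> X y u =
     (let z = transpose_mat X *\<^sub>v y in
      ereal (- 1 / (2 * \<sigma>\<^sup>2) * (u \<bullet> (off_diag (gram X) *\<^sub>v u) - 2 * (z \<bullet> u)))
        - (\<Sum>i<dim_col X. rate_G \<pi> (u $ i) (gram X $$ (i, i) / \<sigma>\<^sup>2)))"

(* Y has law N(\<mu>, \<sigma>^2 I) on R^n, through its joint Lebesgue density; vectors are transported to the
   product space over {..<n} since the type of vectors carries no sigma-algebra. *)
definition gaussian_vec :: "'w measure \<Rightarrow> ('w \<Rightarrow> real vec) \<Rightarrow> nat \<Rightarrow> real vec \<Rightarrow> real \<Rightarrow> bool" where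
  "gaussian_vec \<Omega> Y n \<mu> \<sigma> \<longleftrightarrow>
     (\<forall>\<omega>\<in>space \<Omega>. Y \<omega> \<in> carrier_vec n) \<and>
     distributed \<Omega> (Pi\<^sub>M {..<n} (\<lambda>_. lborel)) (\<lambda>\<omega>. \<lambda>i\<in>{..<n}. Y \<omega> $ i)
       (\<lambda>y. ennreal (\<Prod>i<n. normal_density (\<mu> $ i) \<sigma> (y i)))"

definition random_cube_point :: "'w measure \<Rightarrow> nat \<Rightarrow> ('w \<Rightarrow> real vec) \<Rightarrow> bool" where
  "random_cube_point \<Omega> p U \<longleftrightarrow>
     (\<forall>\<omega>\<in>space \<Omega>. U \<omega> \<in> cube p) \<and> (\<forall>i<p. (\<lambda>\<omega>. U \<omega> $ i) \<in> borel_measurable \<Omega>)"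

(* In the two events below the ereal convention (-\<infinity>) - (-\<infinity>) = \<infinity> is harmless: M_p is finite in the
   interior of the cube, so where M_p (U p \<omega>) = -\<infinity> the inequality fails at every interior u, and in
   the second event a nonempty supremum is then \<infinity>. *)
definition quad_growth ::
  "(nat \<Rightarrow> 'w measure) \<Rightarrow> real \<Rightarrow> real measure \<Rightarrow> (nat \<Rightarrow> real mat) \<Rightarrow> (nat \<Rightarrow> 'w \<Rightarrow> real vec) \<Rightarrow>
   (nat \<Rightarrow> 'w \<Rightarrow> real vec) \<Rightarrow> real \<Rightarrow> bool" where
  "quad_growth \<Omega> \<sigma> \<pi> X Y U \<kappa> \<longleftrightarrow>
     (\<lambda>p. measure (\<Omega> p) {\<omega> \<in> space (\<Omega> p). \<forall>u\<in>cube p.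
        mf_obj \<sigma> \<pi> (X p) (Y p \<omega>) (U p \<omega>) - mf_obj \<sigma> \<pi> (X p) (Y p \<omega>) u
          \<ge> ereal (\<kappa> * sq_dist u (U p \<omega>))}) \<longlonglongrightarrow> 1"

definition well_separated ::
  "(nat \<Rightarrow> 'w measure) \<Rightarrow> real \<Rightarrow> real measure \<Rightarrow> (nat \<Rightarrow> real mat) \<Rightarrow> (nat \<Rightarrow> 'w \<Rightarrow> real vec) \<Rightarrow>
   (nat \<Rightarrow> 'w \<Rightarrow> real vec) \<Rightarrow> bool" where
  "well_separated \<Omega> \<sigma> \<pi> X Y U \<longleftrightarrow>
     (\<forall>\<epsilon>>0. \<exists>\<delta>>0.
       (\<lambda>p. measure (\<Omega> p) {\<omega> \<in> space (\<Omega> p).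
          (SUP u\<in>{u \<in> cube p. sq_dist u (U p \<omega>) > real p * \<epsilon>}.
             ereal (1 / real p)
               * (mf_obj \<sigma> \<pi> (X p) (Y p \<omega>) u - mf_obj \<sigma> \<pi> (X p) (Y p \<omega>) (U p \<omega>)))
          < ereal (- \<delta>)}) \<longlonglongrightarrow> 1)"

end

theory Submission
  imports Defs "HOL-Real_Asymp.Real_Asymp"
begin

text \<open>
Write \<open>c(s)\<close> for the log moment generating function of the prior tilted by \<open>- d z\<^sup>2 / 2\<close>. The
whole theorem rests on one fact about the rate function: \<open>G(\<cdot>, d)\<close> is the Legendre transform of \<open>c\<close>,
\<open>G(u, d) = sup\<^sub>s (u s - c(s) + c(0))\<close>, not only for \<open>\<bar>u\<bar> < 1\<close>, where the supremum is attained at the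
inverse of \<open>c'\<close>, but also at \<open>u = \<plusminus>1\<close>, where it equals the divergence of a point mass
(\<open>rate_G_eq_SUP\<close>). Hence \<open>G\<close> is continuous up to the endpoints as a map into \<open>[0, \<infinity>]\<close>
(\<open>continuous_on_rate_G\<close>), and any bound \<open>k c'' \<le> 1\<close> makes \<open>G\<close> strongly convex with modulus \<open>k\<close>
(\<open>rate_G_strongly_convex\<close>).

Separation follows from quadratic growth because far points satisfy
\<open>M(u\<^sup>*) - M(u) \<ge> \<kappa> p \<epsilon>\<close>. What needs an argument is that the separation event is measurable: it
involves a supremum over an uncountable random set. That set is relatively open in the cube and \<open>M\<close>
is continuous there, so the supremum may be taken over points with rational coordinates
(\<open>SUP_far_points_eq_rational_grid\<close>).

For quadratic growth it is enough that \<open>M + \<kappa> \<parallel>u\<parallel>\<^sup>2\<close> is concave. Under (a), the variance \<open>c''\<close> of a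
variable in \<open>[-1, 1]\<close> is at most 1, so each \<open>G(\<cdot>, d\<^sub>i)\<close> has modulus 1, while \<open>A\<^sub>p\<close> costs at most its largest
absolute row sum (\<open>coercive_diagonally_dominant\<close>). Under (b), \<open>V'\<close> is odd, vanishes at 0, and is
nonnegative and convex on \<open>[0, 1)\<close>; so it is nondecreasing on \<open>(-1, 1)\<close>, and the tilted density is
\<open>exp (- d z\<^sup>2 / 2)\<close> times a log-concave function. One integration by parts then bounds its variance by
\<open>1 / d\<close> (\<open>tilted_var_le_inverse\<close>), so \<open>G(\<cdot>, d\<^sub>i)\<close> has modulus \<open>d\<^sub>i\<close>. These moduli put back exactly the diagonal
that was removed from \<open>X\<^sup>T X\<close> to form \<open>A\<^sub>p\<close>, and the smallest eigenvalue bounds the resulting quadratic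
form (\<open>coercive_lambda_min\<close>).

Either condition gives strong concavity for all large \<open>p\<close> and every value of the response, which enters
\<open>M\<close> linearly. Strong concavity also yields the maximizer: points whose value is within \<open>\<epsilon>\<close> of the supremum
lie within \<open>O(\<surd>\<epsilon>)\<close> of each other, so rational near-maximizers, chosen measurably, form a Cauchy
sequence, and their limit is a measurable maximizer (\<open>measurable_maximizer\<close>). At this point the growth
inequality holds surely.
\<close>

section \<open>Exponential tilts of the prior\<close>

text \<open>The error term of the difference quotient in \<open>moment_has_derivative\<close>.\<close>

lemma exp_sub_affine_bound:
  fixes x :: real
  assumes "\<bar>x\<bar> \<le> 1"
  shows "\<bar>exp x - 1 - x\<bar> \<le> x\<^sup>2"
proof -
  have "exp x \<le> 1 + x + x\<^sup>2"
  proof (cases "0 \<le> x")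
    case True
    then show ?thesis using assms exp_bound by auto
  next
    case False
    have pos: "0 < 1 - x" using False by simp
    have "exp x * (1 - x) \<le> exp x * exp (- x)"
      using exp_ge_add_one_self[of "- x"] by (intro mult_left_mono) auto
    also have "\<dots> = 1" by (simp flip: exp_add)
    also have "1 \<le> (1 + x + x\<^sup>2) * (1 - x)"
    proof -
      have "(1 + x + x\<^sup>2) * (1 - x) = 1 - x * x\<^sup>2"
        by (simp add: algebra_simps power2_eq_square)
      moreover have "x * x\<^sup>2 \<le> 0" using False by (simp add: mult_nonpos_nonneg)
      ultimately show ?thesis by simp
    qed
    finally show ?thesis using pos by simp
  qed
  then show ?thesis using exp_ge_add_one_self[of x] zero_le_power2[of x] by (intro abs_leI) linarith+
qed

lemma above_tangent:
  fixes f f' :: "real \<Rightarrow> real"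
  assumes d: "\<And>x. (f has_real_derivative f' x) (at x)" and m: "mono f'"
  shows "f x + f' x * (y - x) \<le> f y"
proof (cases x y rule: linorder_cases)
  case less
  from MVT2[OF less d] obtain z where z: "x < z" "f y - f x = (y - x) * f' z" by blast
  have "f' x * (y - x) \<le> f' z * (y - x)"
    using less z(1) monoD[OF m, of x z] by (intro mult_right_mono) auto
  with z(2) show ?thesis by (simp add: mult.commute)
next
  case greater
  from MVT2[OF greater d] obtain z where z: "z < x" "f x - f y = (x - y) * f' z" by blast
  have "f' z * (x - y) \<le> f' x * (x - y)"
    using greater z(1) monoD[OF m, of z x] by (intro mult_right_mono) auto
  with z(2) show ?thesis by (simp add: algebra_simps)
qed simp

text \<open>The two endpoints of the support make every tilt non-degenerate: a nonnegative continuous function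
that is positive at 1 or at -1 has a positive integral.\<close>

locale cube_prior = prob_space \<pi> for \<pi> :: "real measure" +
  assumes sets_prior [measurable_cong, simp]: "sets \<pi> = sets borel"
    and concentrated: "measure \<pi> {-1..1} = 1"
    and support_left: "- 1 \<in> msupport \<pi>"
    and support_right: "1 \<in> msupport \<pi>"
begin

lemma space_prior [simp]: "space \<pi> = UNIV"
  using sets_eq_imp_space_eq[OF sets_prior] by simp

lemma AE_prior: "AE z in \<pi>. - 1 \<le> z \<and> z \<le> 1"
  using AE_prob_1[OF concentrated] by (auto simp: )

lemma borel_measurable_prior:
  fixes f :: "real \<Rightarrow> real"
  assumes "continuous_on UNIV f"
  shows "f \<in> borel_measurable \<pi>"
  using borel_measurable_continuous_onI[OF assms] measurable_cong_sets[OF sets_prior refl] by blast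

lemma integrable_prior:
  fixes f :: "real \<Rightarrow> real"
  assumes "continuous_on UNIV f"
  shows "integrable \<pi> f"
proof -
  have "continuous_on {-1..1} f" using assms continuous_on_subset by blast
  then have "bounded (f ` {-1..1})"
    using compact_continuous_image compact_imp_bounded compact_Icc by blast
  then obtain B where B: "\<And>z. z \<in> {-1..1} \<Longrightarrow> norm (f z) \<le> B"
    unfolding bounded_iff by blast
  have "AE z in \<pi>. norm (f z) \<le> B" using AE_prior by eventually_elim (use B in auto)
  then show ?thesis by (rule integrable_const_bound) (rule borel_measurable_prior[OF assms])
qed

lemma integral_prior_mono:
  fixes f g :: "real \<Rightarrow> real"
  assumes "continuous_on UNIV f" "continuous_on UNIV g"
    and "\<And>z. - 1 \<le> z \<Longrightarrow> z \<le> 1 \<Longrightarrow> f z \<le> g z"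
  shows "(\<integral>z. f z \<partial>\<pi>) \<le> (\<integral>z. g z \<partial>\<pi>)"
proof -
  have "AE z in \<pi>. f z \<le> g z" using AE_prior by eventually_elim (auto simp: assms(3))
  then show ?thesis by (intro integral_mono_AE integrable_prior assms)
qed

lemma integral_prior_pos:
  fixes f :: "real \<Rightarrow> real"
  assumes f: "continuous_on UNIV f"
    and nonneg: "\<And>z. - 1 \<le> z \<Longrightarrow> z \<le> 1 \<Longrightarrow> 0 \<le> f z"
    and e: "e = 1 \<or> e = - 1" "0 < f e"
  shows "0 < (\<integral>z. f z \<partial>\<pi>)"
proof (rule ccontr)
  assume neg: "\<not> ?thesis"
  have nn: "AE z in \<pi>. 0 \<le> f z" using AE_prior by eventually_elim (auto intro: nonneg)
  have "0 \<le> (\<integral>z. f z \<partial>\<pi>)" by (rule integral_nonneg_AE[OF nn])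
  then have "(\<integral>z. f z \<partial>\<pi>) = 0" using neg by linarith
  then have "AE z in \<pi>. f z = 0"
    using integral_nonneg_eq_0_iff_AE[OF integrable_prior[OF f] nn] by blast
  then have ae: "AE z in \<pi>. z \<notin> {z. 0 < f z}" by eventually_elim simp
  have op: "open {z. 0 < f z}" by (intro open_Collect_less continuous_intros f)
  then have "{z. 0 < f z} \<in> sets \<pi>" by (metis borel_open sets_prior)
  from AE_iff_null_sets[OF this] ae have "emeasure \<pi> {z. 0 < f z} = 0"
    by (intro null_setsD1) simp
  moreover
  have "e \<in> msupport \<pi>" using e(1) support_left support_right by auto
  then have "0 < emeasure \<pi> {z. 0 < f z}" using op e(2) unfolding msupport_def by blast
  ultimately show False by simp
qed

text \<open>The unnormalized moments of the tilted prior; the derivative in \<open>s\<close> raises \<open>k\<close> by one, so all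
derivatives of the log moment generating function are rational expressions in them.\<close>

definition moment :: "nat \<Rightarrow> real \<Rightarrow> real \<Rightarrow> real" where
  "moment k d s = (\<integral>z. z ^ k * exp (s * z - d * z\<^sup>2 / 2) \<partial>\<pi>)"

lemma continuous_tilt_weight: "continuous_on UNIV (\<lambda>z::real. z ^ k * exp (s * z - d * z\<^sup>2 / 2))"
  by (auto intro!: continuous_intros)

lemma has_integral_moment:
  "has_bochner_integral \<pi> (\<lambda>z. z ^ k * exp (s * z - d * z\<^sup>2 / 2)) (moment k d s)"
  unfolding moment_def by (intro has_bochner_integral_integrable integrable_prior continuous_tilt_weight)

lemma log_mgf_eq: "log_mgf \<pi> s d = ln (moment 0 d s)"
proof -
  have "(LINT z:{-1..1}|\<pi>. exp (s * z - d * z\<^sup>2 / 2)) = moment 0 d s"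
    unfolding moment_def set_lebesgue_integral_def
  proof (rule integral_cong_AE)
    show "AE z in \<pi>. indicat_real {-1..1} z *\<^sub>R exp (s * z - d * z\<^sup>2 / 2)
        = z ^ 0 * exp (s * z - d * z\<^sup>2 / 2)"
      using AE_prior by eventually_elim auto
  qed measurable
  then show ?thesis by (simp add: log_mgf_def)
qed

text \<open>Differentiation under the integral: on \<open>[-1, 1]\<close> the second-order remainder of \<open>exp\<close> is at most \<open>h\<^sup>2\<close>
and the weight is bounded, so the remainder of the integral is \<open>O(h\<^sup>2)\<close>.\<close>

lemma moment_has_derivative: "(moment k d has_real_derivative moment (Suc k) d s) (at s)"
proof -
  define C where "C = exp (\<bar>s\<bar> + \<bar>d\<bar>)"
  have bound: "\<bar>moment k d (s + h) - moment k d s - h * moment (Suc k) d s\<bar> \<le> C * h\<^sup>2" if h: "\<bar>h\<bar> \<le> 1" for h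
  proof -
    let ?f = "\<lambda>z. z ^ k * exp (s * z - d * z\<^sup>2 / 2) * (exp (h * z) - 1 - h * z)"
    have cont: "continuous_on UNIV ?f" by (intro continuous_on_mult continuous_tilt_weight continuous_intros)
    have eq: "moment k d (s + h) - moment k d s - h * moment (Suc k) d s = (\<integral>z. ?f z \<partial>\<pi>)"
    proof -
      have "(\<integral>z. ?f z \<partial>\<pi>) = (\<integral>z. z ^ k * exp ((s + h) * z - d * z\<^sup>2 / 2)
          - z ^ k * exp (s * z - d * z\<^sup>2 / 2)
          - h * (z ^ Suc k * exp (s * z - d * z\<^sup>2 / 2)) \<partial>\<pi>)"
      proof (intro Bochner_Integration.integral_cong refl)
        fix z
        have "exp ((s + h) * z - d * z\<^sup>2 / 2) = exp (s * z - d * z\<^sup>2 / 2) * exp (h * z)"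
          by (simp add: algebra_simps flip: exp_add)
        then show "?f z = z ^ k * exp ((s + h) * z - d * z\<^sup>2 / 2)
          - z ^ k * exp (s * z - d * z\<^sup>2 / 2) - h * (z ^ Suc k * exp (s * z - d * z\<^sup>2 / 2))"
          by (simp only:) (simp add: algebra_simps)
      qed
      also have "\<dots> = moment k d (s + h) - moment k d s - h * moment (Suc k) d s"
        by (intro has_bochner_integral_integral_eq has_bochner_integral_diff
            has_bochner_integral_mult_right has_integral_moment)
      finally show ?thesis by simp
    qed
    have pw: "\<bar>?f z\<bar> \<le> C * h\<^sup>2" if z: "- 1 \<le> z" "z \<le> 1" for z
    proof -
      have az: "\<bar>z\<bar> \<le> 1" using z by auto
      have zk: "\<bar>z ^ k\<bar> \<le> 1" using az by (simp add: power_abs power_le_one)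
      have "s * z \<le> \<bar>s\<bar>"
        using mult_left_mono[OF az, of "\<bar>s\<bar>"] abs_ge_self[of "s * z"] by (simp add: abs_mult)
      moreover have "- (d * z\<^sup>2 / 2) \<le> \<bar>d\<bar>"
      proof -
        have "z\<^sup>2 \<le> 1" using az by (simp add: abs_square_le_1)
        then have "\<bar>d\<bar> * z\<^sup>2 \<le> \<bar>d\<bar>" using mult_left_mono[of "z\<^sup>2" 1 "\<bar>d\<bar>"] by simp
        moreover have "- (d * z\<^sup>2) \<le> \<bar>d\<bar> * z\<^sup>2" using mult_right_mono[of "- d" "\<bar>d\<bar>" "z\<^sup>2"] by simp
        ultimately show ?thesis by linarith
      qed
      ultimately have ex: "exp (s * z - d * z\<^sup>2 / 2) \<le> C" unfolding C_def by simp
      have "\<bar>h * z\<bar> \<le> 1" using h az by (simp add: abs_mult mult_le_one)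
      then have "\<bar>exp (h * z) - 1 - h * z\<bar> \<le> (h * z)\<^sup>2" by (rule exp_sub_affine_bound)
      also have "\<dots> \<le> h\<^sup>2" using az by (simp add: power_mult_distrib mult_left_le abs_square_le_1)
      finally have "\<bar>?f z\<bar> \<le> 1 * C * h\<^sup>2"
        unfolding abs_mult using zk ex by (intro mult_mono) (auto simp: C_def)
      then show ?thesis by simp
    qed
    have "(\<integral>z. ?f z \<partial>\<pi>) \<le> (\<integral>z. C * h\<^sup>2 \<partial>\<pi>)"
      using pw by (intro integral_prior_mono cont continuous_intros) (simp add: abs_le_iff)
    moreover have "(\<integral>z. - (C * h\<^sup>2) \<partial>\<pi>) \<le> (\<integral>z. ?f z \<partial>\<pi>)"
      by (intro integral_prior_mono cont continuous_intros) (use pw in \<open>force simp: abs_le_iff\<close>)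
    ultimately show ?thesis unfolding eq using prob_space by (simp add: abs_le_iff)
  qed
  have "((\<lambda>h. (moment k d (s + h) - moment k d s) / h) \<longlongrightarrow> moment (Suc k) d s) (at 0)"
  proof (rule LIM_zero_cancel, rule Lim_null_comparison)
    show "((\<lambda>h. C * \<bar>h\<bar>) \<longlongrightarrow> 0) (at 0)" by (rule tendsto_eq_intros | simp)+
    have "norm ((moment k d (s + h) - moment k d s) / h - moment (Suc k) d s) \<le> C * \<bar>h\<bar>"
      if h: "h \<noteq> 0" "\<bar>h\<bar> < 1" for h
    proof -
      have "(moment k d (s + h) - moment k d s) / h - moment (Suc k) d s
          = (moment k d (s + h) - moment k d s - h * moment (Suc k) d s) / h"
        using h by (simp add: field_simps)
      then have "norm ((moment k d (s + h) - moment k d s) / h - moment (Suc k) d s)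
          = \<bar>moment k d (s + h) - moment k d s - h * moment (Suc k) d s\<bar> / \<bar>h\<bar>" by simp
      also have "\<dots> \<le> C * h\<^sup>2 / \<bar>h\<bar>" using bound[of h] h by (intro divide_right_mono) auto
      also have "\<dots> = C * \<bar>h\<bar>" using h by (subst power2_abs[symmetric]) (simp add: power2_eq_square del: abs_mult_self_eq)
      finally show ?thesis .
    qed
    then show "\<forall>\<^sub>F h in at 0. norm ((moment k d (s + h) - moment k d s) / h - moment (Suc k) d s) \<le> C * \<bar>h\<bar>"
      unfolding eventually_at by (intro exI[of _ 1]) auto
  qed
  then show ?thesis by (simp add: DERIV_def)
qed

lemma moment0_pos: "0 < moment 0 d s"
  unfolding moment_def by (rule integral_prior_pos[where e = 1]) (auto intro!: continuous_intros)

definition tilted_mean :: "real \<Rightarrow> real \<Rightarrow> real" where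
  "tilted_mean d s = moment 1 d s / moment 0 d s"

definition tilted_var :: "real \<Rightarrow> real \<Rightarrow> real" where
  "tilted_var d s = moment 2 d s / moment 0 d s - (tilted_mean d s)\<^sup>2"

lemma log_mgf_has_derivative:
  "((\<lambda>s. log_mgf \<pi> s d) has_real_derivative tilted_mean d s) (at s)"
  unfolding log_mgf_eq tilted_mean_def using moment0_pos[of d s] moment_has_derivative[of 0 d s]
  by (auto intro!: derivative_eq_intros)

lemma log_mgf_dot_eq: "log_mgf_dot \<pi> s d = tilted_mean d s"
  unfolding log_mgf_dot_def by (rule DERIV_imp_deriv log_mgf_has_derivative)+

lemma tilted_mean_has_derivative: "(tilted_mean d has_real_derivative tilted_var d s) (at s)"
proof -
  have "((\<lambda>s. moment 1 d s / moment 0 d s) has_real_derivative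
      (moment 2 d s * moment 0 d s - moment 1 d s * moment 1 d s) / (moment 0 d s * moment 0 d s)) (at s)"
    using DERIV_divide[OF moment_has_derivative[of 1 d s] moment_has_derivative[of 0 d s]] moment0_pos[of d s]
    by (simp add: numeral_2_eq_2)
  moreover have "(moment 2 d s * moment 0 d s - moment 1 d s * moment 1 d s) / (moment 0 d s * moment 0 d s) = tilted_var d s"
    using moment0_pos[of d s] by (simp add: tilted_var_def tilted_mean_def field_simps power2_eq_square)
  ultimately show ?thesis unfolding tilted_mean_def[abs_def] by simp
qed

lemma centred_moment:
  "(\<integral>z. (z - a)\<^sup>2 * exp (s * z - d * z\<^sup>2 / 2) \<partial>\<pi>) = moment 2 d s - 2 * a * moment 1 d s + a\<^sup>2 * moment 0 d s"
proof -
  have "(\<integral>z. (z - a)\<^sup>2 * exp (s * z - d * z\<^sup>2 / 2) \<partial>\<pi>)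
      = (\<integral>z. z ^ 2 * exp (s * z - d * z\<^sup>2 / 2) - 2 * a * (z ^ 1 * exp (s * z - d * z\<^sup>2 / 2))
          + a\<^sup>2 * (z ^ 0 * exp (s * z - d * z\<^sup>2 / 2)) \<partial>\<pi>)"
    by (intro Bochner_Integration.integral_cong refl) (simp add: algebra_simps power2_eq_square)
  also have "\<dots> = moment 2 d s - 2 * a * moment 1 d s + a\<^sup>2 * moment 0 d s"
    by (intro has_bochner_integral_integral_eq has_bochner_integral_diff has_bochner_integral_add
        has_bochner_integral_mult_right has_integral_moment)
  finally show ?thesis .
qed

lemma tilted_var_eq_centred:
  "tilted_var d s * moment 0 d s = (\<integral>z. (z - tilted_mean d s)\<^sup>2 * exp (s * z - d * z\<^sup>2 / 2) \<partial>\<pi>)"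
  unfolding centred_moment using moment0_pos[of d s]
  by (simp add: tilted_var_def tilted_mean_def field_simps power2_eq_square)

text \<open>The squared distance to the mean vanishes at only one point, hence it is positive at 1 or at -1.\<close>

lemma tilted_var_pos: "0 < tilted_var d s"
proof -
  define a where "a = tilted_mean d s"
  define e :: real where "e = (if a = 1 then - 1 else 1)"
  have "0 < (\<integral>z. (z - a)\<^sup>2 * exp (s * z - d * z\<^sup>2 / 2) \<partial>\<pi>)"
    by (rule integral_prior_pos[where e = e]) (auto intro!: continuous_intros simp: e_def)
  then show ?thesis using tilted_var_eq_centred[of d s] moment0_pos[of d s]
    by (metis a_def zero_less_mult_pos2)
qed

lemma tilted_var_le_one: "tilted_var d s \<le> 1"
proof -
  have "moment 2 d s \<le> moment 0 d s" unfolding moment_def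
    by (intro integral_prior_mono continuous_tilt_weight) (auto simp: abs_square_le_1 abs_le_iff)
  then have "moment 2 d s / moment 0 d s \<le> 1" using moment0_pos[of d s] by simp
  then show ?thesis unfolding tilted_var_def using zero_le_power2[of "tilted_mean d s"] by linarith
qed

lemma tilted_mean_strict_mono: "strict_mono (tilted_mean d)"
proof (rule strict_monoI)
  fix s s' :: real assume "s < s'"
  then show "tilted_mean d s < tilted_mean d s'"
    by (rule DERIV_pos_imp_increasing) (metis tilted_mean_has_derivative tilted_var_pos)
qed

text \<open>If the mean of every tilt in direction \<open>e\<close> stayed on the near side of \<open>u\<close>, then \<open>c(e r) - e r u\<close> would stay
below \<open>c(0)\<close> for all \<open>r \<ge> 0\<close>. But the support reaches beyond \<open>u\<close>, and \<open>exp x \<ge> max 0 x\<close> shows that the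
corresponding integral grows at least linearly in \<open>r\<close>. With \<open>e = 1\<close> and \<open>e = -1\<close> this shows that the mean
ranges over all of \<open>(-1, 1)\<close>.\<close>

lemma tilted_mean_exceeds:
  assumes e: "e = 1 \<or> e = - 1" and u: "e * u < 1"
  shows "\<exists>s. e * u < e * tilted_mean d s"
proof (rule ccontr)
  assume "\<not> ?thesis"
  then have le: "e * tilted_mean d s \<le> e * u" for s by (auto simp: not_less)
  define J where "J = (\<integral>z. max 0 (e * (z - u)) * exp (- (d * z\<^sup>2 / 2)) \<partial>\<pi>)"
  have J: "0 < J" unfolding J_def
    by (rule integral_prior_pos[where e = e])
      (use e u in \<open>auto intro!: continuous_intros mult_pos_pos simp: less_max_iff_disj\<close>)
  have bound: "r * J \<le> moment 0 d 0" if r: "0 \<le> r" for r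
  proof -
    have "log_mgf \<pi> (e * r) d + tilted_mean d (e * r) * (0 - e * r) \<le> log_mgf \<pi> 0 d"
      by (rule above_tangent[OF log_mgf_has_derivative strict_mono_mono[OF tilted_mean_strict_mono]])
    moreover have "r * (e * tilted_mean d (e * r)) \<le> r * (e * u)"
      by (rule mult_left_mono[OF le r])
    ultimately have "log_mgf \<pi> (e * r) d \<le> log_mgf \<pi> 0 d + r * (e * u)"
      by (simp add: algebra_simps)
    then have "exp (log_mgf \<pi> (e * r) d) \<le> exp (log_mgf \<pi> 0 d + r * (e * u))" by simp
    then have le1: "moment 0 d (e * r) \<le> moment 0 d 0 * exp (r * (e * u))"
      using moment0_pos by (simp add: log_mgf_eq exp_add)
    have "r * J = (\<integral>z. r * (max 0 (e * (z - u)) * exp (- (d * z\<^sup>2 / 2))) \<partial>\<pi>)"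
      unfolding J_def by simp
    also have "\<dots> \<le> (\<integral>z. exp (- (r * (e * u))) * (z ^ 0 * exp ((e * r) * z - d * z\<^sup>2 / 2)) \<partial>\<pi>)"
    proof (intro integral_prior_mono continuous_on_mult continuous_tilt_weight; (auto intro!: continuous_intros; fail)?)
      fix z
      let ?x = "r * (e * (z - u))"
      have "r * max 0 (e * (z - u)) = max 0 ?x" using r by (simp add: max_mult_distrib_left)
      also have "\<dots> \<le> exp ?x" using exp_ge_add_one_self[of ?x] exp_gt_zero[of ?x]
        by (intro max.boundedI) linarith+
      finally have "r * max 0 (e * (z - u)) * exp (- (d * z\<^sup>2 / 2)) \<le> exp ?x * exp (- (d * z\<^sup>2 / 2))"
        by (intro mult_right_mono) auto
      then show "r * (max 0 (e * (z - u)) * exp (- (d * z\<^sup>2 / 2)))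
          \<le> exp (- (r * (e * u))) * (z ^ 0 * exp ((e * r) * z - d * z\<^sup>2 / 2))"
        by (simp add: algebra_simps flip: exp_add)
    qed
    also have "\<dots> = exp (- (r * (e * u))) * moment 0 d (e * r)" by (simp add: moment_def)
    also have "\<dots> \<le> exp (- (r * (e * u))) * (moment 0 d 0 * exp (r * (e * u)))"
      by (intro mult_left_mono le1) auto
    also have "\<dots> = moment 0 d 0" by (simp add: exp_minus)
    finally show ?thesis .
  qed
  have "(moment 0 d 0 / J + 1) * J \<le> moment 0 d 0"
    by (rule bound) (use moment0_pos[of d 0] J in simp)
  moreover have "(moment 0 d 0 / J + 1) * J = moment 0 d 0 + J" using J by (simp add: field_simps)
  ultimately show False using J by linarith
qed

lemma ex1_tilted_mean:
  assumes "\<bar>u\<bar> < 1"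
  shows "\<exists>!s. tilted_mean d s = u"
proof (rule ex_ex1I)
  obtain s1 where s1: "u < tilted_mean d s1" using tilted_mean_exceeds[of 1 u d] assms by (auto simp: abs_less_iff)
  obtain s2 where s2: "tilted_mean d s2 < u" using tilted_mean_exceeds[of "- 1" u d] assms by (auto simp: abs_less_iff)
  have "s2 < s1" using s1 s2 strict_mono_less[OF tilted_mean_strict_mono, of d s2 s1] by linarith
  moreover have "continuous_on {s2..s1} (tilted_mean d)"
    by (meson DERIV_continuous_on has_field_derivative_at_within tilted_mean_has_derivative)
  ultimately show "\<exists>s. tilted_mean d s = u" using IVT'[of "tilted_mean d" s2 u s1] s1 s2 by force
next
  fix s s' assume "tilted_mean d s = u" "tilted_mean d s' = u"
  then show "s = s'" using strict_mono_eq[OF tilted_mean_strict_mono] by metis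
qed

lemma tilted_mean_tilt_inv:
  assumes "\<bar>u\<bar> < 1"
  shows "tilted_mean d (tilt_inv \<pi> u d) = u"
  unfolding tilt_inv_def log_mgf_dot_eq using theI'[OF ex1_tilted_mean[OF assms]] .

text \<open>The affine functions of \<open>u\<close> whose supremum over \<open>s\<close> is \<open>G(\<cdot>, d)\<close>.\<close>

definition tilt_line :: "real \<Rightarrow> real \<Rightarrow> real \<Rightarrow> real" where
  "tilt_line d s u = u * s - log_mgf \<pi> s d + log_mgf \<pi> 0 d"

lemma tilt_line_le_tilt_inv:
  assumes "\<bar>u\<bar> < 1"
  shows "tilt_line d s u \<le> tilt_line d (tilt_inv \<pi> u d) u"
  using above_tangent[OF log_mgf_has_derivative strict_mono_mono[OF tilted_mean_strict_mono], of "tilt_inv \<pi> u d" d s]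
  unfolding tilt_line_def tilted_mean_tilt_inv[OF assms] by (simp add: algebra_simps)

lemma rate_G_interior:
  assumes "\<bar>u\<bar> < 1"
  shows "rate_G \<pi> u d = ereal (tilt_line d (tilt_inv \<pi> u d) u)"
  using assms by (simp add: rate_G_def tilt_line_def)

end

section \<open>The rate function G as a Legendre transform\<close>

context cube_prior begin

text \<open>The mass that the tilt with \<open>s = 0\<close> puts on an endpoint, before normalization.\<close>

definition atom_weight :: "real \<Rightarrow> real \<Rightarrow> real" where
  "atom_weight d e = measure \<pi> {e} * exp (- (d / 2))"

lemma integral_at_atom:
  assumes "e = 1 \<or> e = - 1"
  shows "has_bochner_integral \<pi> (\<lambda>z. indicator {e} z * exp (- (d / 2))) (atom_weight d e)"
proof -
  have "has_bochner_integral \<pi> (\<lambda>z. indicat_real {e} z) (measure \<pi> {e})"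
    by (intro has_bochner_integral_real_indicator) (auto simp: emeasure_eq_measure)
  then show ?thesis unfolding atom_weight_def by (rule has_bochner_integral_mult_left)
qed

lemma moment0_ge_atom_weight:
  assumes e: "e = 1 \<or> e = - 1"
  shows "exp (s * e) * atom_weight d e \<le> moment 0 d s"
proof -
  have hb: "has_bochner_integral \<pi> (\<lambda>z. exp (s * e) * (indicator {e} z * exp (- (d / 2))))
      (exp (s * e) * atom_weight d e)"
    by (rule has_bochner_integral_mult_right[OF integral_at_atom[OF e]])
  have "(\<integral>z. exp (s * e) * (indicator {e} z * exp (- (d / 2))) \<partial>\<pi>)
      \<le> (\<integral>z. z ^ 0 * exp (s * z - d * z\<^sup>2 / 2) \<partial>\<pi>)"
  proof (rule integral_mono_AE)
    show "AE z in \<pi>. exp (s * e) * (indicator {e} z * exp (- (d / 2)))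
        \<le> z ^ 0 * exp (s * z - d * z\<^sup>2 / 2)"
      using e by (intro AE_I2) (auto simp: indicator_def simp flip: exp_add)
  qed (use hb has_integral_moment[of 0 s d] in \<open>auto simp: has_bochner_integral_iff\<close>)
  then show ?thesis using has_bochner_integral_integral_eq[OF hb] by (simp add: moment_def)
qed

text \<open>As the tilt towards \<open>e\<close> grows, the integrand normalized at \<open>e\<close> decreases to its restriction to
\<open>{e}\<close>. This identifies the limit of the affine functions at an endpoint.\<close>

lemma moment0_concentrates_at_atom:
  assumes e: "e = 1 \<or> e = - 1"
  shows "(\<lambda>n. moment 0 d (e * real n) * exp (- real n)) \<longlonglongrightarrow> atom_weight d e"
proof -
  have ee: "e * e = 1" using e by auto
  let ?f = "\<lambda>n z. exp (real n * (e * z - 1)) * exp (- (d * z\<^sup>2 / 2))"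
  let ?l = "\<lambda>z. indicator {e} z * exp (- (d / 2))"
  have "(\<lambda>n. \<integral>z. ?f n z \<partial>\<pi>) \<longlonglongrightarrow> (\<integral>z. ?l z \<partial>\<pi>)"
  proof (rule integral_dominated_convergence)
    show "integrable \<pi> (\<lambda>z. exp (- (d * z\<^sup>2 / 2)))"
      by (rule integrable_prior) (auto intro!: continuous_intros)
    show "AE z in \<pi>. (\<lambda>n. ?f n z) \<longlonglongrightarrow> ?l z"
      using AE_prior
    proof eventually_elim
      fix z :: real assume z: "- 1 \<le> z \<and> z \<le> 1"
      show "(\<lambda>n. ?f n z) \<longlonglongrightarrow> ?l z"
      proof (cases "z = e")
        case True
        then show ?thesis using ee e by auto
      next
        case False
        define q where "q = exp (e * z - 1)"
        have "e * z - 1 < 0" using e z False by auto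
        then have "0 < q" "q < 1" by (auto simp: q_def)
        then have "(\<lambda>n. q ^ n * exp (- (d * z\<^sup>2 / 2))) \<longlonglongrightarrow> 0 * exp (- (d * z\<^sup>2 / 2))"
          by (intro tendsto_intros LIMSEQ_realpow_zero) auto
        then show ?thesis using False by (simp add: q_def exp_of_nat_mult)
      qed
    qed
    show "AE z in \<pi>. norm (?f n z) \<le> exp (- (d * z\<^sup>2 / 2))" for n
      using AE_prior
    proof eventually_elim
      fix z :: real assume z: "- 1 \<le> z \<and> z \<le> 1"
      then have "real n * (e * z - 1) \<le> 0" using e by (intro mult_nonneg_nonpos) auto
      then show "norm (?f n z) \<le> exp (- (d * z\<^sup>2 / 2))" by simp
    qed
  qed measurable
  moreover have "(\<integral>z. ?l z \<partial>\<pi>) = atom_weight d e"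
    by (rule has_bochner_integral_integral_eq[OF integral_at_atom[OF e]])
  moreover have "(\<integral>z. ?f n z \<partial>\<pi>) = moment 0 d (e * real n) * exp (- real n)" for n
    unfolding moment_def
    by (subst integral_mult_left_zero[symmetric])
      (auto intro!: Bochner_Integration.integral_cong simp: algebra_simps simp flip: exp_add)
  ultimately show ?thesis by simp
qed

lemma emeasure_tilted_point:
  assumes e: "e = 1 \<or> e = - 1"
  shows "emeasure (tilted \<pi> 0 d) {e} = ennreal (exp (- log_mgf \<pi> 0 d) * atom_weight d e)"
proof -
  have "emeasure (tilted \<pi> 0 d) {e}
      = (\<integral>\<^sup>+z. ennreal (exp (0 * z - d / 2 * z\<^sup>2 - log_mgf \<pi> 0 d)) * indicator {e} z \<partial>\<pi>)"
    unfolding tilted_def by (subst emeasure_density) auto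
  also have "\<dots> = ennreal (exp (0 * e - d / 2 * e\<^sup>2 - log_mgf \<pi> 0 d)) * emeasure \<pi> {e}"
    by (rule nn_integral_indicator_singleton) auto
  also have "\<dots> = ennreal (exp (- log_mgf \<pi> 0 d) * atom_weight d e)"
  proof -
    have "exp (0 * e - d / 2 * e\<^sup>2 - log_mgf \<pi> 0 d) = exp (- log_mgf \<pi> 0 d) * exp (- (d / 2))"
      using e by (auto simp flip: exp_add)
    then show ?thesis by (simp add: atom_weight_def emeasure_eq_measure ennreal_mult[symmetric] mult_ac)
  qed
  finally show ?thesis .
qed

text \<open>A point mass is absolutely continuous with respect to the tilted prior only if there is an atom, and
its density at the atom is then the inverse of the mass.\<close>

lemma rate_G_endpoint:
  assumes e: "e = 1 \<or> e = - 1"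
  shows "rate_G \<pi> e d = (if atom_weight d e = 0 then \<infinity> else ereal (log_mgf \<pi> 0 d - ln (atom_weight d e)))"
proof -
  let ?Q = "tilted \<pi> 0 d" and ?P = "return borel e"
  have G: "rate_G \<pi> e d = KL_ext ?P ?Q" using e by (auto simp: rate_G_def)
  have setsQ [measurable_cong, simp]: "sets ?Q = sets borel" by (simp add: tilted_def)
  have atom_nonneg: "0 \<le> atom_weight d e" by (simp add: atom_weight_def)
  define q where "q = exp (- log_mgf \<pi> 0 d) * atom_weight d e"
  note Qe = emeasure_tilted_point[OF e, of d, folded q_def]
  show ?thesis
  proof (cases "atom_weight d e = 0")
    case True
    then have "{e} \<in> null_sets ?Q" using Qe by (auto simp: q_def null_sets_def)
    moreover have "{e} \<notin> null_sets ?P" by (auto simp: null_sets_def)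
    ultimately have "\<not> absolutely_continuous ?Q ?P" unfolding absolutely_continuous_def by blast
    then show ?thesis using True G by (simp add: KL_ext_def)
  next
    case False
    then have pos: "0 < atom_weight d e" "0 < q" using atom_nonneg by (auto simp: q_def)
    have ac: "absolutely_continuous ?Q ?P"
      unfolding absolutely_continuous_def
    proof
      fix N assume N: "N \<in> null_sets ?Q"
      then have Nb: "N \<in> sets borel" by (auto simp: null_sets_def)
      have "e \<notin> N"
      proof
        assume "e \<in> N"
        then have "emeasure ?Q {e} \<le> emeasure ?Q N" using Nb by (intro emeasure_mono) auto
        then show False using N pos Qe by (auto simp: null_sets_def)
      qed
      then show "N \<in> null_sets ?P" using Nb by (auto simp: null_sets_def)
    qed
    interpret Q: finite_measure ?Q
    proof (rule finite_measureI)
      have "emeasure ?Q (space ?Q)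
          = (\<integral>\<^sup>+z. ennreal (exp (0 * z - d / 2 * z\<^sup>2 - log_mgf \<pi> 0 d)) \<partial>\<pi>)"
        unfolding tilted_def by (simp add: emeasure_density)
      also have "\<dots> \<noteq> \<infinity>"
        by (intro integrableD(2) integrable_prior continuous_intros)
      finally show "emeasure ?Q (space ?Q) \<noteq> \<infinity>" .
    qed
    let ?r = "RN_deriv ?Q ?P"
    have "density ?Q ?r = ?P" by (rule Q.density_RN_deriv[OF ac]) simp
    then have "1 = emeasure (density ?Q ?r) {e}" by simp
    also have "\<dots> = (\<integral>\<^sup>+z. ?r z * indicator {e} z \<partial>?Q)" by (rule emeasure_density) auto
    also have "\<dots> = ?r e * emeasure ?Q {e}" by (rule nn_integral_indicator_singleton) auto
    finally have "1 = enn2real (?r e * ennreal q)" using Qe by simp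
    then have rn: "enn2real (?r e) = 1 / q" using pos by (simp add: enn2real_mult field_simps)
    define E where "E = entropy_density (exp 1) ?Q ?P"
    have E_meas [measurable]: "E \<in> borel_measurable borel"
      using measurable_entropy_density[of "exp 1" ?Q ?P] measurable_cong_sets[OF setsQ refl]
      unfolding E_def by blast
    have P: "prob_space ?P" by (rule prob_space_return) simp
    have "integrable ?P E"
      by (rule finite_measure.integrable_const_bound[where B = "\<bar>E e\<bar>"])
        (use P in \<open>auto simp: prob_space_def AE_return\<close>)
    moreover have "KL_divergence (exp 1) ?Q ?P = E e"
      unfolding KL_divergence_def E_def[symmetric] by (rule integral_return) auto
    moreover have "E e = log_mgf \<pi> 0 d - ln (atom_weight d e)"
      using pos unfolding E_def entropy_density_def comp_apply rn
      by (simp add: log_def q_def ln_div ln_mult)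
    ultimately show ?thesis using False G ac by (simp add: KL_ext_def E_def)
  qed
qed

text \<open>In the interior, convexity of \<open>c\<close> shows that the critical point \<open>tilt_inv\<close> attains the supremum. At an
endpoint every affine function lies below \<open>G\<close>, because the moment generating function dominates the
contribution of the atom, and \<open>G\<close> is the limit along tilts towards the endpoint.\<close>

lemma rate_G_eq_SUP:
  assumes "\<bar>u\<bar> \<le> 1"
  shows "rate_G \<pi> u d = (SUP s. ereal (tilt_line d s u))"
proof (cases "\<bar>u\<bar> < 1")
  case True
  then show ?thesis using tilt_line_le_tilt_inv[OF True, of d]
    by (intro antisym SUP_upper2[where i = "tilt_inv \<pi> u d"] SUP_least)
      (auto simp: rate_G_interior)
next
  case False
  then have e: "u = 1 \<or> u = - 1" using assms by linarith
  then have uu: "u * u = 1" by auto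
  note lim = moment0_concentrates_at_atom[OF e, of d]
  have tilt_line_eq: "tilt_line d (u * real n) u = log_mgf \<pi> 0 d - ln (moment 0 d (u * real n) * exp (- real n))" for n
    using moment0_pos[of d "u * real n"] uu by (simp add: tilt_line_def log_mgf_eq ln_mult flip: mult.assoc)
  have below: "ereal (tilt_line d s u) \<le> rate_G \<pi> u d" for s
  proof (cases "atom_weight d u = 0")
    case False
    then have pos: "0 < atom_weight d u" by (simp add: atom_weight_def zero_less_measure_iff)
    have "ln (exp (s * u) * atom_weight d u) \<le> ln (moment 0 d s)"
      using moment0_ge_atom_weight[OF e, of s d] moment0_pos[of d s] pos by simp
    then have "s * u + ln (atom_weight d u) \<le> ln (moment 0 d s)" using pos by (simp add: ln_mult)
    then show ?thesis using False rate_G_endpoint[OF e]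
      by (simp add: tilt_line_def log_mgf_eq mult.commute)
  qed (simp add: rate_G_endpoint[OF e])
  have above: "rate_G \<pi> u d \<le> (SUP s. ereal (tilt_line d s u))"
  proof (cases "atom_weight d u = 0")
    case False
    then have "(\<lambda>n. tilt_line d (u * real n) u) \<longlonglongrightarrow> log_mgf \<pi> 0 d - ln (atom_weight d u)"
      unfolding tilt_line_eq by (intro tendsto_intros lim)
    then have "(\<lambda>n. ereal (tilt_line d (u * real n) u)) \<longlonglongrightarrow> rate_G \<pi> u d"
      using False by (simp add: rate_G_endpoint[OF e])
    then show ?thesis by (rule LIMSEQ_le_const2) (auto intro!: SUP_upper)
  next
    case True
    have "ereal B \<le> (SUP s. ereal (tilt_line d s u))" for B
    proof -
      have "\<forall>\<^sub>F n in sequentially. moment 0 d (u * real n) * exp (- real n) < exp (log_mgf \<pi> 0 d - B)"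
        using order_tendstoD(2)[OF lim] True by auto
      then obtain n where n: "moment 0 d (u * real n) * exp (- real n) < exp (log_mgf \<pi> 0 d - B)"
        by (auto simp: eventually_sequentially)
      have "ln (moment 0 d (u * real n) * exp (- real n)) < log_mgf \<pi> 0 d - B"
        using n moment0_pos[of d "u * real n"] ln_less_cancel_iff[of _ "exp (log_mgf \<pi> 0 d - B)"] by simp
      then have "ereal B \<le> ereal (tilt_line d (u * real n) u)" unfolding tilt_line_eq by simp
      then show ?thesis by (rule order_trans) (auto intro: SUP_upper)
    qed
    then have "(SUP s. ereal (tilt_line d s u)) = \<infinity>" by (rule ereal_top)
    then show ?thesis by simp
  qed
  show ?thesis using below above by (intro antisym SUP_least) auto
qed

lemma tilt_line_le_rate_G: "\<bar>u\<bar> \<le> 1 \<Longrightarrow> ereal (tilt_line d s u) \<le> rate_G \<pi> u d"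
  by (simp add: rate_G_eq_SUP) (auto intro: SUP_upper)

lemma rate_G_nonneg: "\<bar>u\<bar> \<le> 1 \<Longrightarrow> 0 \<le> rate_G \<pi> u d"
  using tilt_line_le_rate_G[of u d 0] by (simp add: tilt_line_def zero_ereal_def)

text \<open>The function \<open>s\<^sup>2 / 2 - k c(s)\<close> has a nondecreasing derivative, so it lies above its tangents.
Multiplying by \<open>k\<close> instead of dividing covers \<open>k = 0\<close>, which occurs for a zero column of the design
matrix.\<close>

lemma log_mgf_quadratic_upper:
  assumes k: "\<And>s. k * tilted_var d s \<le> 1"
  shows "k * log_mgf \<pi> s' d \<le> k * log_mgf \<pi> s d + k * tilted_mean d s * (s' - s) + (s' - s)\<^sup>2 / 2"
proof -
  have "mono (\<lambda>s. s - k * tilted_mean d s)"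
  proof (rule monoI)
    fix x y :: real assume "x \<le> y"
    then show "x - k * tilted_mean d x \<le> y - k * tilted_mean d y"
    proof (rule DERIV_nonneg_imp_nondecreasing)
      fix s
      have "((\<lambda>s. s - k * tilted_mean d s) has_real_derivative 1 - k * tilted_var d s) (at s)"
        by (auto intro!: derivative_eq_intros tilted_mean_has_derivative)
      then show "\<exists>y. ((\<lambda>s. s - k * tilted_mean d s) has_real_derivative y) (at s) \<and> 0 \<le> y"
        using k[of s] by auto
    qed
  qed
  moreover have "((\<lambda>s. s\<^sup>2 / 2 - k * log_mgf \<pi> s d) has_real_derivative s - k * tilted_mean d s) (at s)" for s
    by (auto intro!: derivative_eq_intros log_mgf_has_derivative)
  ultimately have "s\<^sup>2 / 2 - k * log_mgf \<pi> s d + (s - k * tilted_mean d s) * (s' - s)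
      \<le> s'\<^sup>2 / 2 - k * log_mgf \<pi> s' d" by (rule above_tangent[rotated])
  moreover have "(s' - s)\<^sup>2 / 2 = s'\<^sup>2 / 2 - s\<^sup>2 / 2 - s * (s' - s)"
    by (simp add: field_simps power2_eq_square)
  ultimately show ?thesis by (simp add: algebra_simps)
qed

text \<open>Legendre duality between the quadratic upper bound of \<open>c\<close> and strong convexity of \<open>G\<close>: the supremum that
defines \<open>G(v)\<close> is bounded below by its value at \<open>s = h + k (v - w)\<close>, the maximizer for the quadratic upper
bound.\<close>

lemma rate_G_subgradient:
  assumes k: "0 \<le> k" "\<And>s. k * tilted_var d s \<le> 1" and w: "\<bar>w\<bar> < 1" and v: "\<bar>v\<bar> \<le> 1"
  defines "h \<equiv> tilt_inv \<pi> w d"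
  shows "ereal (tilt_line d h w + h * (v - w) + k / 2 * (v - w)\<^sup>2) \<le> rate_G \<pi> v d"
proof -
  let ?s = "h + k * (v - w)"
  have tm: "tilted_mean d h = w" unfolding h_def by (rule tilted_mean_tilt_inv[OF w])
  have "log_mgf \<pi> ?s d \<le> log_mgf \<pi> h d + w * (k * (v - w)) + k * (v - w)\<^sup>2 / 2"
  proof (cases "k = 0")
    case False
    have "k * log_mgf \<pi> ?s d \<le> k * log_mgf \<pi> h d + k * w * (?s - h) + (?s - h)\<^sup>2 / 2"
      using log_mgf_quadratic_upper[OF k(2), of ?s h] by (simp add: tm)
    also have "\<dots> = k * (log_mgf \<pi> h d + w * (k * (v - w)) + k * (v - w)\<^sup>2 / 2)"
      by (simp add: algebra_simps power2_eq_square)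
    finally show ?thesis using False k(1) by simp
  qed simp
  moreover have "v * ?s - w * (k * (v - w)) - k * (v - w)\<^sup>2 / 2 = v * h + k / 2 * (v - w)\<^sup>2"
    by (simp add: field_simps power2_eq_square)
  ultimately have "tilt_line d h w + h * (v - w) + k / 2 * (v - w)\<^sup>2 \<le> tilt_line d ?s v"
    unfolding tilt_line_def by (simp add: algebra_simps)
  then show ?thesis using tilt_line_le_rate_G[OF v, of d ?s] by (metis ereal_less_eq(3) order_trans)
qed

text \<open>Average the subgradient inequality at the intermediate point. That point is an endpoint of the interval
only if \<open>u\<close> and \<open>v\<close> coincide with it.\<close>

lemma rate_G_strongly_convex:
  assumes k: "0 \<le> k" "\<And>s. k * tilted_var d s \<le> 1"
    and u: "\<bar>u\<bar> \<le> 1" "rate_G \<pi> u d = ereal a"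
    and v: "\<bar>v\<bar> \<le> 1" "rate_G \<pi> v d = ereal b"
    and t: "0 \<le> t" "t \<le> 1"
  shows "rate_G \<pi> ((1 - t) * u + t * v) d \<le> ereal ((1 - t) * a + t * b - k / 2 * (t * (1 - t)) * (u - v)\<^sup>2)"
proof -
  define w where "w = (1 - t) * u + t * v"
  consider "t = 0" | "t = 1" | "0 < t" "t < 1" using t by linarith
  then show ?thesis
  proof cases
    case 3
    have lin: "(1 - t) * (- 1) + t * (- 1) \<le> w" "w \<le> (1 - t) * 1 + t * 1"
      unfolding w_def using u(1) v(1) t by (intro add_mono mult_left_mono; simp add: abs_le_iff)+
    show ?thesis
    proof (cases "\<bar>w\<bar> < 1")
      case True
      define h where "h = tilt_inv \<pi> w d"
      define g where "g = tilt_line d h w"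
      have A: "g + h * (u - w) + k / 2 * (u - w)\<^sup>2 \<le> a"
        using rate_G_subgradient[OF k True u(1)] u(2) by (simp add: h_def g_def)
      have B: "g + h * (v - w) + k / 2 * (v - w)\<^sup>2 \<le> b"
        using rate_G_subgradient[OF k True v(1)] v(2) by (simp add: h_def g_def)
      have "(1 - t) * (g + h * (u - w) + k / 2 * (u - w)\<^sup>2) + t * (g + h * (v - w) + k / 2 * (v - w)\<^sup>2)
          \<le> (1 - t) * a + t * b"
        by (intro add_mono mult_left_mono A B) (use t in auto)
      moreover have "(1 - t) * (g + h * (u - w) + k / 2 * (u - w)\<^sup>2)
          + t * (g + h * (v - w) + k / 2 * (v - w)\<^sup>2) = g + k / 2 * (t * (1 - t)) * (u - v)\<^sup>2"
        unfolding w_def by (simp add: field_simps power2_eq_square)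
      ultimately have "g \<le> (1 - t) * a + t * b - k / 2 * (t * (1 - t)) * (u - v)\<^sup>2" by linarith
      then show ?thesis using rate_G_interior[OF True, of d] by (simp add: w_def h_def g_def)
    next
      case False
      then have "w = 1 \<or> w = - 1" using lin by auto
      then have "u = w \<and> v = w"
      proof
        assume w1: "w = 1"
        have "(1 - t) * (1 - u) + t * (1 - v) = 0" using w1 by (simp add: w_def algebra_simps)
        moreover have "0 \<le> (1 - t) * (1 - u)" "0 \<le> t * (1 - v)" using u v 3 by auto
        ultimately show ?thesis using 3 w1 by (simp add: add_nonneg_eq_0_iff)
      next
        assume w1: "w = - 1"
        have "(1 - t) * (1 + u) + t * (1 + v) = 0" using w1 by (simp add: w_def algebra_simps)
        moreover have "0 \<le> (1 - t) * (1 + u)" "0 \<le> t * (1 + v)" using u v 3 by auto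
        ultimately show ?thesis using 3 w1 by (auto simp: add_nonneg_eq_0_iff)
      qed
      moreover have "(1 - t) * x + t * x = x" for x by (simp add: algebra_simps)
      ultimately show ?thesis using u(2) v(2) by (simp add: w_def[symmetric])
    qed
  qed (use u v in auto)
qed

text \<open>Lower semicontinuity is that of a supremum of affine functions. In the interior a finite convex function
is continuous; at an endpoint with a finite value, convexity on the segment from 0 bounds \<open>G\<close> from above.\<close>

lemma continuous_on_rate_G: "continuous_on {-1..1} (\<lambda>u. rate_G \<pi> u d)"
proof -
  let ?g = "\<lambda>u. tilt_line d (tilt_inv \<pi> u d) u"
  have "convex_on {-1<..<1} ?g"
  proof (rule convex_onI)
    fix t x y :: real assume *: "0 < t" "t < 1" "x \<in> {-1<..<1}" "y \<in> {-1<..<1}"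
    then have ax: "\<bar>x\<bar> < 1" "\<bar>y\<bar> < 1" by auto
    have "(1 - t) * x + t * y \<in> {-1<..<1}"
      using * convexD[of "{-1<..<1::real}" x y "1 - t" t] by (simp del: greaterThanLessThan_iff)
    then have "\<bar>(1 - t) * x + t * y\<bar> < 1" by auto
    from rate_G_interior[OF this, of d]
      rate_G_strongly_convex[of 0 d x _ y _ t, OF _ _ _ rate_G_interior[OF ax(1)] _ rate_G_interior[OF ax(2)]]
    show "?g ((1 - t) *\<^sub>R x + t *\<^sub>R y) \<le> (1 - t) * ?g x + t * ?g y"
      using * ax by simp
  qed simp
  then have "continuous_on {-1<..<1} ?g" by (intro convex_on_continuous) auto
  then have "continuous_on {-1<..<1} (\<lambda>u. ereal (?g u))" by (rule continuous_on_ereal)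
  then have co: "continuous_on {-1<..<1} (\<lambda>u. rate_G \<pi> u d)"
    by (rule continuous_on_cong[THEN iffD1, rotated -1]) (auto simp: rate_G_interior)
  then have inner: "isCont (\<lambda>u. rate_G \<pi> u d) u" if "\<bar>u\<bar> < 1" for u
  proof -
    have "u \<in> {-1<..<1}" using that by auto
    then show ?thesis
      using co[unfolded continuous_on_eq_continuous_at[OF open_greaterThanLessThan]] by (rule bspec[rotated])
  qed
  have lower: "\<forall>\<^sub>F v in at u within {-1..1}. a < rate_G \<pi> v d"
    if "u \<in> {-1..1}" "a < rate_G \<pi> u d" for u a
  proof -
    have "\<bar>u\<bar> \<le> 1" using that(1) by auto
    with that(2) have "\<exists>s. a < ereal (tilt_line d s u)"
      by (auto simp: rate_G_eq_SUP less_SUP_iff)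
    then obtain s where s: "a < ereal (tilt_line d s u)" by blast
    have "((\<lambda>v. ereal (tilt_line d s v)) \<longlongrightarrow> ereal (tilt_line d s u)) (at u within {-1..1})"
      unfolding tilt_line_def by (intro tendsto_intros)
    from order_tendstoD(1)[OF this s]
    have "\<forall>\<^sub>F v in at u within {-1..1}. a < ereal (tilt_line d s v)" .
    moreover have "\<forall>\<^sub>F v in at u within {-1..1}. v \<in> {-1..1}"
      by (simp add: eventually_at_filter)
    ultimately show ?thesis
      by eventually_elim (metis abs_le_iff atLeastAtMost_iff less_le_trans minus_le_iff tilt_line_le_rate_G)
  qed
  have endpoint: "\<forall>\<^sub>F v in at e within {-1..1}. rate_G \<pi> v d < a"
    if e: "e = 1 \<or> e = - 1" and a: "rate_G \<pi> e d < a" for e a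
  proof -
    have ee: "e * e = 1" using e by auto
    have fin: "rate_G \<pi> e d \<noteq> \<infinity>" "rate_G \<pi> e d \<noteq> - \<infinity>"
      using a rate_G_nonneg[of e d] e by auto
    then obtain b where b: "rate_G \<pi> e d = ereal b" by (cases "rate_G \<pi> e d") auto
    obtain c where c: "rate_G \<pi> 0 d = ereal c" using rate_G_interior[of 0 d] by auto
    have "((\<lambda>v. ereal ((1 - e * v) * c + (e * v) * b)) \<longlongrightarrow> ereal ((1 - e * e) * c + (e * e) * b))
        (at e within {-1..1})"
      by (intro tendsto_intros)
    then have "\<forall>\<^sub>F v in at e within {-1..1}. ereal ((1 - e * v) * c + (e * v) * b) < a"
      by (rule order_tendstoD(2)) (use a b ee in simp)
    moreover have "\<forall>\<^sub>F v in at e within {-1..1}. 0 < e * v"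
      by (rule order_tendstoD(1)[OF tendsto_mult[OF tendsto_const tendsto_ident_at]]) (simp add: ee)
    moreover have "\<forall>\<^sub>F v in at e within {-1..1}. v \<in> {-1..1}"
      by (simp add: eventually_at_filter)
    ultimately show ?thesis
    proof eventually_elim
      case (elim v)
      have "e * v \<le> 1" using elim(3) e by auto
      then have "rate_G \<pi> ((1 - e * v) * 0 + (e * v) * e) d
          \<le> ereal ((1 - e * v) * c + (e * v) * b - 0 / 2 * ((e * v) * (1 - e * v)) * (0 - e)\<^sup>2)"
        using elim(2) e by (intro rate_G_strongly_convex b c) auto
      moreover have "(1 - e * v) * 0 + (e * v) * e = v"
      proof -
        have "(e * v) * e = (e * e) * v" by (simp only: mult_ac)
        then show ?thesis by (simp add: ee)
      qed
      ultimately have "rate_G \<pi> v d \<le> ereal ((1 - e * v) * c + (e * v) * b)" by (simp only:) simp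
      then show ?case using elim(1) by (rule le_less_trans)
    qed
  qed
  show ?thesis
    unfolding continuous_on_def
  proof
    fix u :: real assume u: "u \<in> {-1..1}"
    show "((\<lambda>u. rate_G \<pi> u d) \<longlongrightarrow> rate_G \<pi> u d) (at u within {-1..1})"
    proof (cases "\<bar>u\<bar> < 1")
      case True
      then show ?thesis using inner isCont_def tendsto_within_subset by blast
    next
      case False
      then have "u = 1 \<or> u = - 1" using u by auto
      then show ?thesis by (intro order_tendstoI lower endpoint u)
    qed
  qed
qed

end

section \<open>Variance of a tilted log-concave prior\<close>

text \<open>A convex function that vanishes at 0 and is nonnegative is nondecreasing; here it is extended by
oddness to the negative half.\<close>

lemma even_convex_deriv_mono:
  fixes V :: "real \<Rightarrow> real"
  assumes even: "\<And>x. x \<in> {-1..1} \<Longrightarrow> V (- x) = V x" and inc: "mono_on {0..1} V"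
    and diff: "\<And>x. x \<in> {-1<..<1} \<Longrightarrow> V field_differentiable at x"
    and conv: "convex_on {0..<1} (deriv V)"
  shows "mono_on {-1<..<1} (deriv V)"
proof -
  have D: "(V has_real_derivative deriv V x) (at x)" if "x \<in> {-1<..<1}" for x
    using diff[OF that] by (simp add: field_differentiable_derivI)
  have odd: "deriv V (- x) = - deriv V x" if x: "x \<in> {-1<..<1}" for x
  proof -
    have dv: "((\<lambda>y. V (- y)) has_real_derivative - deriv V (- x)) (at x)"
    proof -
      have "((\<lambda>y::real. - y) has_real_derivative - 1) (at x)"
        by (auto intro!: derivative_eq_intros)
      from DERIV_chain2[OF D this] x show ?thesis by simp
    qed
    have "\<forall>\<^sub>F y in nhds x. y \<in> {-1<..<1}"
      by (intro eventually_nhds_in_open x) simp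
    then have ev: "\<forall>\<^sub>F y in nhds x. V (- y) = V y"
      by eventually_elim (auto intro!: even)
    have "(V has_real_derivative - deriv V (- x)) (at x)"
      by (rule DERIV_cong_ev[OF refl ev refl, THEN iffD1, OF dv])
    then show ?thesis using DERIV_unique[OF D[OF x]] by simp
  qed
  have zero: "deriv V 0 = 0" using odd[of 0] by simp
  have nonneg: "0 \<le> deriv V x" if x: "x \<in> {0..<1}" for x
  proof (cases "x = 0")
    case False
    then have "x \<in> interior {0..1}" using x by simp
    then show ?thesis using mono_on_imp_deriv_nonneg[OF inc D] x by simp
  qed (simp add: zero)
  have mono_pos: "deriv V x \<le> deriv V y" if "0 \<le> x" "x \<le> y" "y < 1" for x y
  proof (cases "y = 0")
    case False
    define t where "t = x / y"
    have t: "0 \<le> t" "t \<le> 1" "x = t * y" using that False by (auto simp: t_def)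
    have "deriv V ((1 - t) *\<^sub>R 0 + t *\<^sub>R y) \<le> (1 - t) * deriv V 0 + t * deriv V y"
      by (rule convex_onD[OF conv]) (use that t in auto)
    then have "deriv V x \<le> t * deriv V y" by (simp add: zero t(3))
    also have "\<dots> \<le> deriv V y" using t nonneg[of y] that by (simp add: mult_left_le_one_le)
    finally show ?thesis .
  qed (use that in auto)
  show ?thesis
  proof (rule mono_onI)
    fix x y :: real assume xy: "x \<in> {-1<..<1}" "y \<in> {-1<..<1}" "x \<le> y"
    consider "0 \<le> x" | "y \<le> 0" | "x < 0" "0 < y" by linarith
    then show "deriv V x \<le> deriv V y"
    proof cases
      case 1 then show ?thesis using mono_pos xy by auto
    next
      case 2
      then have "deriv V (- y) \<le> deriv V (- x)" using xy by (intro mono_pos) auto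
      then show ?thesis using odd xy by auto
    next
      case 3
      then have "0 \<le> deriv V (- x)" "0 \<le> deriv V y" using xy by (auto intro!: nonneg)
      then show ?thesis using odd[of x] xy by auto
    qed
  qed
qed

text \<open>Let \<open>W(z) = V(z) + d z\<^sup>2 / 2 - s z\<close>, so \<open>f = exp (- W)\<close>, and \<open>H(z) = (z - m) f(z)\<close>. Monotonicity of \<open>V'\<close> gives
\<open>(z - m) (W'(z) - W'(m)) \<ge> d (z - m)\<^sup>2\<close>, so the integrand is at most \<open>- H'\<close>, and
\<open>H(r) \<ge> 0 \<ge> H(- r)\<close>. The interval stays inside \<open>(-1, 1)\<close> because \<open>V\<close> may jump at the endpoints.\<close>

lemma log_concave_variance_inequality:
  fixes V V' :: "real \<Rightarrow> real" and s :: real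
  assumes D: "\<And>x. x \<in> {-1<..<1} \<Longrightarrow> (V has_real_derivative V' x) (at x)"
    and mono: "mono_on {-1<..<1} V'" and d: "0 \<le> d"
    and m: "\<bar>m\<bar> \<le> r" and r: "r < 1"
  defines "f \<equiv> (\<lambda>z. exp (s * z - d * z\<^sup>2 / 2 - V z))"
  shows "(LBINT z:{-r..r}. (d * (z - m)\<^sup>2 - 1 + (z - m) * (V' m + d * m - s)) * f z) \<le> 0"
proof -
  let ?\<psi> = "\<lambda>z. (d * (z - m)\<^sup>2 - 1 + (z - m) * (V' m + d * m - s)) * f z"
  let ?H = "\<lambda>z. (z - m) * f z"
  let ?H' = "\<lambda>z. f z - (z - m) * (V' z + d * z - s) * f z"
  have sub: "z \<in> {-1<..<1}" if "z \<in> {-r..r}" for z using that r by auto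
  have Df: "(f has_real_derivative - (V' z + d * z - s) * f z) (at z)" if "z \<in> {-1<..<1}" for z
    unfolding f_def by (auto intro!: derivative_eq_intros D[OF that] simp: algebra_simps)
  have DH: "(?H has_real_derivative ?H' z) (at z)" if "z \<in> {-1<..<1}" for z
    by (auto intro!: derivative_eq_intros Df[OF that] simp: algebra_simps)
  have "(?H' has_integral (?H r - ?H (- r))) {-r..r}"
  proof (rule fundamental_theorem_of_calculus)
    fix z assume "z \<in> {-r..r}"
    from DH[OF sub[OF this]] show "(?H has_vector_derivative ?H' z) (at z within {-r..r})"
      by (simp add: has_real_derivative_iff_has_vector_derivative has_vector_derivative_at_within)
  qed (use m in auto)
  then have I1: "((\<lambda>z. - ?H' z) has_integral - (?H r - ?H (- r))) {-r..r}" by (rule has_integral_neg)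
  have fcont: "continuous_on {-r..r} f"
    by (rule DERIV_continuous_on) (rule has_field_derivative_at_within[OF Df[OF sub]])
  have contp: "continuous_on {-r..r} ?\<psi>" by (intro continuous_intros fcont)
  have si: "set_integrable lborel {-r..r} ?\<psi>"
    by (rule borel_integrable_atLeastAtMost'[OF contp])
  have I2: "(?\<psi> has_integral integral {-r..r} ?\<psi>) {-r..r}"
    using integrable_continuous_real[OF contp] by (rule integrable_integral)
  have "integral {-r..r} ?\<psi> \<le> - (?H r - ?H (- r))"
  proof (rule has_integral_le[OF I2 I1])
    fix z assume z: "z \<in> {-r..r}"
    have mi: "m \<in> {-1<..<1}" using m r by auto
    have "0 \<le> (z - m) * (V' z - V' m)"
    proof (cases "m \<le> z")
      case True
      then have "V' m \<le> V' z" using mono_onD[OF mono mi sub[OF z]] by simp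
      then show ?thesis using True by simp
    next
      case False
      then have "V' z \<le> V' m" using mono_onD[OF mono sub[OF z] mi] by simp
      then show ?thesis using False by (simp add: mult_nonpos_nonpos)
    qed
    then have "d * (z - m)\<^sup>2 - 1 + (z - m) * (V' m + d * m - s) \<le> (z - m) * (V' z + d * z - s) - 1"
      by (simp add: algebra_simps power2_eq_square)
    then have "?\<psi> z \<le> ((z - m) * (V' z + d * z - s) - 1) * f z"
      by (rule mult_right_mono) (simp add: f_def)
    then show "?\<psi> z \<le> - ?H' z" by (simp add: algebra_simps)
  qed
  moreover have "0 \<le> ?H r" "?H (- r) \<le> 0"
    using m by (auto simp: f_def mult_nonpos_nonneg)
  ultimately have "integral {-r..r} ?\<psi> \<le> 0" by linarith
  then show ?thesis using set_borel_integral_eq_integral(2)[OF si] by simp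
qed

context cube_prior begin

lemma tilted_mean_abs_less_one: "\<bar>tilted_mean d s\<bar> < 1"
proof -
  have hb: "has_bochner_integral \<pi>
      (\<lambda>z. z ^ 0 * exp (s * z - d * z\<^sup>2 / 2) - e * (z ^ 1 * exp (s * z - d * z\<^sup>2 / 2)))
      (moment 0 d s - e * moment 1 d s)" for e
    by (intro has_bochner_integral_diff has_bochner_integral_mult_right has_integral_moment)
  have "0 < moment 0 d s - e * moment 1 d s" if e: "e = 1 \<or> e = - 1" for e
  proof -
    have "0 < (\<integral>z. z ^ 0 * exp (s * z - d * z\<^sup>2 / 2) - e * (z ^ 1 * exp (s * z - d * z\<^sup>2 / 2)) \<partial>\<pi>)"
    proof (rule integral_prior_pos[where e = "- e"])
      show "continuous_on UNIV
          (\<lambda>z. z ^ 0 * exp (s * z - d * z\<^sup>2 / 2) - e * (z ^ 1 * exp (s * z - d * z\<^sup>2 / 2)))"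
        by (intro continuous_on_diff continuous_on_mult continuous_tilt_weight continuous_on_const)
    qed (use e in auto)
    then show ?thesis using has_bochner_integral_integral_eq[OF hb] by simp
  qed
  from this[of 1] this[of "- 1"] show ?thesis
    using moment0_pos[of d s] by (simp add: tilted_mean_def abs_less_iff field_simps)
qed

text \<open>Let \<open>r\<close> tend to 1 in the preceding inequality, with \<open>m\<close> the mean of the tilted prior. The linear term then
integrates to zero, and what remains is \<open>d\<close> times the variance minus 1, up to normalization.\<close>

lemma tilted_var_le_inverse:
  assumes Z: "Z > 0"
    and dens: "\<pi> = density lborel (\<lambda>x. ennreal (indicator {-1..1} x * (1 / Z * exp (- V x))))"
    and D: "\<And>x. x \<in> {-1<..<1} \<Longrightarrow> (V has_real_derivative V' x) (at x)"
    and mono: "mono_on {-1<..<1} V'" and d: "0 \<le> d"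
  shows "d * tilted_var d s \<le> 1"
proof -
  define m where "m = tilted_mean d s"
  define C where "C = V' m + d * m - s"
  let ?\<psi> = "\<lambda>z. d * (z - m)\<^sup>2 - 1 + (z - m) * C"
  let ?w = "\<lambda>z. exp (s * z - d * z\<^sup>2 / 2)"
  let ?g = "\<lambda>x. indicator {-1..1} x * (1 / Z * exp (- V x))"
  let ?F = "\<lambda>z. ?\<psi> z * ?w z"
  have m1: "\<bar>m\<bar> < 1" unfolding m_def by (rule tilted_mean_abs_less_one)
  have "continuous_on {-1<..<1} V"
    by (rule DERIV_continuous_on) (rule has_field_derivative_at_within[OF D])
  then have "(\<lambda>x. indicator {-1<..<1} x *\<^sub>R exp (- V x)) \<in> borel_measurable borel"
    by (intro borel_measurable_continuous_on_indicator continuous_intros) auto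
  then have [measurable]: "(\<lambda>x. indicator {-1<..<1} x * exp (- V x)) \<in> borel_measurable borel" by simp
  \<comment> \<open>For measurability: V is continuous in the open interval, and the two endpoints are split off.\<close>
  have g_eq: "?g = (\<lambda>x. 1 / Z * (indicator {-1<..<1} x * exp (- V x)
      + indicator {1} x * exp (- V 1) + indicator {-1} x * exp (- V (-1))))"
    by (auto simp: fun_eq_iff indicator_def)
  have g_meas [measurable]: "?g \<in> borel_measurable borel" unfolding g_eq by measurable
  have Fcont: "continuous_on UNIV ?F" by (auto intro!: continuous_intros)
  have Fint: "integrable \<pi> ?F" by (rule integrable_prior[OF Fcont])
  have Fm [measurable]: "?F \<in> borel_measurable borel" by measurable
  have gF: "integrable lborel (\<lambda>x. ?g x * ?F x)"
    using Fint integrable_density[of ?F lborel ?g] g_meas Fm Z unfolding dens by simp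
  have eqI: "(\<integral>z. ?F z \<partial>\<pi>) = (\<integral>x. ?g x * ?F x \<partial>lborel)"
    using integral_density[of ?F lborel ?g] g_meas Fm Z unfolding dens by simp
  \<comment> \<open>Radii that stay between the absolute value of the mean and 1, and tend to 1.\<close>
  define r where "r n = 1 - (1 - \<bar>m\<bar>) * (1 / (real n + 2))" for n
  have r: "\<bar>m\<bar> \<le> r n" "r n < 1" for n
  proof -
    have "(1 - \<bar>m\<bar>) * (1 / (real n + 2)) \<le> (1 - \<bar>m\<bar>) * 1"
      using m1 by (intro mult_left_mono) auto
    moreover have "0 < (1 - \<bar>m\<bar>) * (1 / (real n + 2))" using m1 by (intro mult_pos_pos) auto
    ultimately show "\<bar>m\<bar> \<le> r n" "r n < 1" by (auto simp: r_def)
  qed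
  have r_lim: "r \<longlonglongrightarrow> 1" unfolding r_def by real_asymp
  have "(\<lambda>n. \<integral>x. indicator {- r n..r n} x * (?g x * ?F x) \<partial>lborel) \<longlonglongrightarrow> (\<integral>x. ?g x * ?F x \<partial>lborel)"
  proof (rule integral_dominated_convergence[where w = "\<lambda>x. norm (?g x * ?F x)"])
    have "AE x in lborel. x \<noteq> (1::real)" "AE x in lborel. x \<noteq> (-1::real)"
      by (rule AE_lborel_singleton)+
    then show "AE x in lborel. (\<lambda>n. indicator {- r n..r n} x * (?g x * ?F x)) \<longlonglongrightarrow> ?g x * ?F x"
    proof eventually_elim
      case (elim x)
      show ?case
      proof (cases "\<bar>x\<bar> < 1")
        case True
        then have "\<forall>\<^sub>F n in sequentially. \<bar>x\<bar> < r n" using order_tendstoD(1)[OF r_lim] by simp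
        then have "\<forall>\<^sub>F n in sequentially. indicator {- r n..r n} x * (?g x * ?F x) = ?g x * ?F x"
          by eventually_elim (auto simp: indicator_def)
        then show ?thesis by (rule tendsto_eventually)
      next
        case False
        then have "x \<notin> {-1..1}" using elim by auto
        then show ?thesis by simp
      qed
    qed
    show "integrable lborel (\<lambda>x. norm (?g x * ?F x))" using gF by (rule integrable_norm)
    show "AE x in lborel. norm (indicator {- r n..r n} x * (?g x * ?F x)) \<le> norm (?g x * ?F x)" for n
      by (auto simp: indicator_def)
  qed measurable
  moreover have "(\<integral>x. indicator {- r n..r n} x * (?g x * ?F x) \<partial>lborel) \<le> 0" for n
  proof -
    have "(\<integral>x. indicator {- r n..r n} x * (?g x * ?F x) \<partial>lborel)
        = (LBINT z:{- r n..r n}. 1 / Z * (?\<psi> z * exp (s * z - d * z\<^sup>2 / 2 - V z)))"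
      unfolding set_lebesgue_integral_def
    proof (intro Bochner_Integration.integral_cong refl)
      fix z
      have "indicator {- r n..r n} z * indicator {-1..1} z = (indicator {- r n..r n} z :: real)"
        using r[of n] by (auto simp: indicator_def)
      moreover have "exp (s * z - d * z\<^sup>2 / 2 - V z) = ?w z * exp (- V z)"
        by (simp flip: exp_add)
      ultimately show "indicator {- r n..r n} z * (?g z * ?F z)
          = indicator {- r n..r n} z *\<^sub>R (1 / Z * (?\<psi> z * exp (s * z - d * z\<^sup>2 / 2 - V z)))"
        by (auto simp: mult_ac)
    qed
    also have "\<dots> = 1 / Z * (LBINT z:{- r n..r n}. ?\<psi> z * exp (s * z - d * z\<^sup>2 / 2 - V z))"
      by (rule set_integral_mult_right)
    also have "\<dots> \<le> 0"
      using log_concave_variance_inequality[OF D mono d r, of n s] Z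
      by (intro mult_nonneg_nonpos) (auto simp: C_def)
    finally show ?thesis .
  qed
  ultimately have "(\<integral>z. ?F z \<partial>\<pi>) \<le> 0"
    unfolding eqI by (intro LIMSEQ_le_const2) auto
  moreover have "(\<integral>z. ?F z \<partial>\<pi>) = d * (tilted_var d s * moment 0 d s) - moment 0 d s"
  proof -
    have hb: "has_bochner_integral \<pi> (\<lambda>z. d * ((z - m)\<^sup>2 * ?w z) - z ^ 0 * ?w z
        + C * (z ^ 1 * ?w z) - C * m * (z ^ 0 * ?w z))
        (d * (tilted_var d s * moment 0 d s) - moment 0 d s + C * moment 1 d s - C * m * moment 0 d s)"
      unfolding tilted_var_eq_centred m_def
      by (intro has_bochner_integral_diff has_bochner_integral_add has_bochner_integral_mult_right
          has_integral_moment has_bochner_integral_integrable integrable_prior)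
        (auto intro!: continuous_intros)
    have "C * moment 1 d s - C * m * moment 0 d s = 0"
      using moment0_pos[of d s] by (simp add: m_def tilted_mean_def)
    moreover have "(\<integral>z. ?F z \<partial>\<pi>) = (\<integral>z. d * ((z - m)\<^sup>2 * ?w z) - z ^ 0 * ?w z
        + C * (z ^ 1 * ?w z) - C * m * (z ^ 0 * ?w z) \<partial>\<pi>)"
      by (intro Bochner_Integration.integral_cong refl) (simp add: algebra_simps)
    ultimately show ?thesis using has_bochner_integral_integral_eq[OF hb] by simp
  qed
  ultimately have "(d * tilted_var d s) * moment 0 d s \<le> 1 * moment 0 d s" by simp
  then show ?thesis using moment0_pos[of d s] by (rule mult_right_le_imp_le)
qed

end

section \<open>The smallest eigenvalue of a symmetric matrix\<close>

lemma scalar_prod_mult_mat_vec_sum: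
  fixes B :: "real mat"
  assumes "B \<in> carrier_mat p p" "x \<in> carrier_vec p" "y \<in> carrier_vec p"
  shows "x \<bullet> (B *\<^sub>v y) = (\<Sum>i<p. \<Sum>j<p. B $$ (i, j) * x $ i * y $ j)"
proof -
  have "x \<bullet> (B *\<^sub>v y) = (\<Sum>i<p. x $ i * (\<Sum>j<p. B $$ (i, j) * y $ j))"
    using assms by (auto simp: scalar_prod_def lessThan_atLeast0 intro!: sum.cong)
  then show ?thesis by (simp add: sum_distrib_left mult_ac)
qed

lemma sum_quadratic_form_le:
  fixes a :: "nat \<Rightarrow> nat \<Rightarrow> real"
  shows "\<bar>\<Sum>i<p. \<Sum>j<p. a i j * x i * x j\<bar>
    \<le> (\<Sum>i<p. \<Sum>j<p. \<bar>a i j\<bar> * ((x i)\<^sup>2 + (x j)\<^sup>2) / 2)"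
proof -
  have "\<bar>a i j * x i * x j\<bar> \<le> \<bar>a i j\<bar> * ((x i)\<^sup>2 + (x j)\<^sup>2) / 2" for i j
  proof -
    have "\<bar>x i\<bar> * \<bar>x j\<bar> \<le> ((x i)\<^sup>2 + (x j)\<^sup>2) / 2"
      using sum_squares_bound[of "\<bar>x i\<bar>" "\<bar>x j\<bar>"] by simp
    from mult_left_mono[OF this, of "\<bar>a i j\<bar>"] show ?thesis by (simp add: abs_mult mult.assoc)
  qed
  then show ?thesis
    by (intro order_trans[OF sum_abs] sum_mono)
qed

lemma quadratic_form_bounded:
  fixes B :: "real mat"
  assumes B: "B \<in> carrier_mat p p"
  shows "\<exists>C>0. \<forall>x\<in>carrier_vec p. \<bar>x \<bullet> (B *\<^sub>v x)\<bar> \<le> C * (x \<bullet> x)"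
proof (intro exI conjI ballI)
  let ?C = "\<Sum>i<p. \<Sum>j<p. \<bar>B $$ (i, j)\<bar>"
  show "0 < 1 + ?C" by (intro add_pos_nonneg sum_nonneg) auto
  fix x :: "real vec" assume x: "x \<in> carrier_vec p"
  have xx: "x \<bullet> x = (\<Sum>i<p. (x $ i)\<^sup>2)"
    using x by (auto simp: scalar_prod_def lessThan_atLeast0 power2_eq_square)
  have comp: "(x $ i)\<^sup>2 \<le> x \<bullet> x" if "i < p" for i
    unfolding xx by (rule member_le_sum) (use that in auto)
  have "\<bar>x \<bullet> (B *\<^sub>v x)\<bar> \<le> (\<Sum>i<p. \<Sum>j<p. \<bar>B $$ (i, j)\<bar> * ((x $ i)\<^sup>2 + (x $ j)\<^sup>2) / 2)"
    unfolding scalar_prod_mult_mat_vec_sum[OF B x x] by (rule sum_quadratic_form_le)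
  also have "\<dots> \<le> (\<Sum>i<p. \<Sum>j<p. \<bar>B $$ (i, j)\<bar> * (x \<bullet> x))"
  proof (intro sum_mono)
    fix i j assume "i \<in> {..<p}" "j \<in> {..<p}"
    then have "((x $ i)\<^sup>2 + (x $ j)\<^sup>2) / 2 \<le> x \<bullet> x" using comp[of i] comp[of j] by simp
    from mult_left_mono[OF this, of "\<bar>B $$ (i, j)\<bar>"]
    show "\<bar>B $$ (i, j)\<bar> * ((x $ i)\<^sup>2 + (x $ j)\<^sup>2) / 2 \<le> \<bar>B $$ (i, j)\<bar> * (x \<bullet> x)" by simp
  qed
  also have "\<dots> = ?C * (x \<bullet> x)" by (simp add: sum_distrib_right)
  also have "\<dots> \<le> (1 + ?C) * (x \<bullet> x)"
    by (intro mult_right_mono) (auto simp: xx sum_nonneg)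
  finally show "\<bar>x \<bullet> (B *\<^sub>v x)\<bar> \<le> (1 + ?C) * (x \<bullet> x)" .
qed

text \<open>For a positive semidefinite symmetric \<open>S\<close> the squared length of \<open>S x\<close> is at most a multiple of \<open>x \<bullet> S x\<close>,
and invertibility bounds \<open>x\<close> by \<open>S x\<close>.\<close>

lemma psd_form_coercive:
  fixes S :: "real mat"
  assumes S: "S \<in> carrier_mat p p" and sym: "transpose_mat S = S" and det: "det S \<noteq> 0"
    and psd: "\<And>x. x \<in> carrier_vec p \<Longrightarrow> 0 \<le> x \<bullet> (S *\<^sub>v x)"
  shows "\<exists>c>0. \<forall>x\<in>carrier_vec p. c * (x \<bullet> x) \<le> x \<bullet> (S *\<^sub>v x)"
proof -
  obtain T where T: "T \<in> carrier_mat p p" "T * S = 1\<^sub>m p"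
    using det_non_zero_imp_unit[OF S det] unfolding Units_def ring_mat_def by auto
  have TT: "transpose_mat T * T \<in> carrier_mat p p" using T by simp
  obtain C where C: "C > 0" "\<And>x. x \<in> carrier_vec p \<Longrightarrow> \<bar>x \<bullet> (S *\<^sub>v x)\<bar> \<le> C * (x \<bullet> x)"
    using quadratic_form_bounded[OF S] by blast
  obtain D where D: "D > 0"
      "\<And>x. x \<in> carrier_vec p \<Longrightarrow> \<bar>x \<bullet> ((transpose_mat T * T) *\<^sub>v x)\<bar> \<le> D * (x \<bullet> x)"
    using quadratic_form_bounded[OF TT] by blast
  show ?thesis
  proof (intro exI conjI ballI)
    show "0 < 1 / (C * D)" using C D by simp
    fix x :: "real vec" assume x: "x \<in> carrier_vec p"
    define y where "y = S *\<^sub>v x"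
    have y: "y \<in> carrier_vec p" using S x by (simp add: y_def)
    have Sy: "S *\<^sub>v y \<in> carrier_vec p" using S y by simp
    have "x = T *\<^sub>v y" unfolding y_def
      using T S x by (metis assoc_mult_mat_vec one_mult_mat_vec)
    moreover have Ty: "T *\<^sub>v y \<in> carrier_vec p" using T y by simp
    moreover have "y \<bullet> (transpose_mat T *\<^sub>v (T *\<^sub>v y)) = (T *\<^sub>v y) \<bullet> (T *\<^sub>v y)"
      using transpose_vec_mult_scalar[OF T(1) y Ty] comm_scalar_prod[OF y, of "transpose_mat T *\<^sub>v (T *\<^sub>v y)"]
        T(1) Ty by simp
    ultimately have "x \<bullet> x = y \<bullet> ((transpose_mat T * T) *\<^sub>v y)"
      using T y by simp
    then have xy: "x \<bullet> x \<le> D * (y \<bullet> y)" using D(2)[OF y] by simp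
    \<comment> \<open>The form is nonnegative at the point reached from x by a gradient step of length 1/C.\<close>
    have sxy: "y \<bullet> y = x \<bullet> (S *\<^sub>v y)"
      using transpose_vec_mult_scalar[OF S y x] unfolding sym y_def by simp
    have "0 \<le> (x - (1 / C) \<cdot>\<^sub>v y) \<bullet> (S *\<^sub>v (x - (1 / C) \<cdot>\<^sub>v y))"
      using x y by (intro psd) simp
    also have "S *\<^sub>v (x - (1 / C) \<cdot>\<^sub>v y) = y - (1 / C) \<cdot>\<^sub>v (S *\<^sub>v y)"
      using S x y by (simp add: y_def mult_minus_distrib_mat_vec mult_mat_vec)
    also have "(x - (1 / C) \<cdot>\<^sub>v y) \<bullet> (y - (1 / C) \<cdot>\<^sub>v (S *\<^sub>v y))
        = x \<bullet> y - (1 / C) * (x \<bullet> (S *\<^sub>v y)) - (1 / C) * (y \<bullet> y) + (1 / C)\<^sup>2 * (y \<bullet> (S *\<^sub>v y))"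
      using x y Sy by (simp add: minus_scalar_prod_distrib scalar_prod_minus_distrib algebra_simps power2_eq_square)
    also have "\<dots> \<le> x \<bullet> y - (1 / C) * (y \<bullet> y)"
    proof -
      have "(1 / C)\<^sup>2 * (y \<bullet> (S *\<^sub>v y)) \<le> (1 / C)\<^sup>2 * (C * (y \<bullet> y))"
        using C(2)[OF y] by (intro mult_left_mono) auto
      also have "\<dots> = (1 / C) * (y \<bullet> y)" using C(1) by (simp add: power2_eq_square)
      finally show ?thesis using sxy by simp
    qed
    finally have "(1 / C) * (y \<bullet> y) \<le> x \<bullet> y" by simp
    moreover have "(1 / (C * D)) * (x \<bullet> x) \<le> (1 / (C * D)) * (D * (y \<bullet> y))"
      using xy C D by (intro mult_left_mono) auto
    ultimately show "1 / (C * D) * (x \<bullet> x) \<le> x \<bullet> (S *\<^sub>v x)"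
      using D(1) by (simp add: y_def)
  qed
qed

text \<open>The best constant \<open>m\<close> with \<open>m (x \<bullet> x) \<le> x \<bullet> B x\<close> is itself an eigenvalue, hence at least the smallest
one: otherwise \<open>B - m I\<close> would be invertible and positive semidefinite, so its form would be coercive.\<close>

lemma lambda_min_le_quadratic_form:
  fixes B :: "real mat"
  assumes B: "B \<in> carrier_mat p p" and sym: "transpose_mat B = B" and p: "0 < p"
    and x: "x \<in> carrier_vec p"
  shows "lambda_min B * (x \<bullet> x) \<le> x \<bullet> (B *\<^sub>v x)"
proof -
  define K where "K = {k. \<forall>x \<in> carrier_vec p. k * (x \<bullet> x) \<le> x \<bullet> (B *\<^sub>v x)}"
  define m where "m = Sup K"
  obtain C where C: "C > 0" "\<And>x. x \<in> carrier_vec p \<Longrightarrow> \<bar>x \<bullet> (B *\<^sub>v x)\<bar> \<le> C * (x \<bullet> x)"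
    using quadratic_form_bounded[OF B] by blast
  have "- C \<in> K" unfolding K_def
  proof (intro CollectI ballI)
    fix x :: "real vec" assume "x \<in> carrier_vec p"
    from abs_le_D2[OF C(2)[OF this]] show "- C * (x \<bullet> x) \<le> x \<bullet> (B *\<^sub>v x)" by simp
  qed
  have bdd: "bdd_above K"
  proof (rule bdd_aboveI)
    fix k assume "k \<in> K"
    let ?e = "unit_vec p 0 :: real vec"
    have e: "?e \<in> carrier_vec p" by simp
    have "k * (?e \<bullet> ?e) \<le> ?e \<bullet> (B *\<^sub>v ?e)" using \<open>k \<in> K\<close> e unfolding K_def by blast
    also have "\<dots> \<le> C * (?e \<bullet> ?e)" using abs_le_D1[OF C(2)[OF e]] .
    finally show "k \<le> C" using p by simp
  qed
  have nonneg: "0 \<le> x \<bullet> x" if "x \<in> carrier_vec p" for x :: "real vec"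
    by (simp add: scalar_prod_def sum_nonneg)
  have mK: "m \<in> K"
    unfolding K_def
  proof (intro CollectI ballI)
    fix x :: "real vec" assume x: "x \<in> carrier_vec p"
    show "m * (x \<bullet> x) \<le> x \<bullet> (B *\<^sub>v x)"
    proof (cases "x \<bullet> x = 0")
      case True
      then show ?thesis using C(2)[OF x] by simp
    next
      case False
      then have pos: "0 < x \<bullet> x" using nonneg[OF x] by simp
      have "m \<le> x \<bullet> (B *\<^sub>v x) / (x \<bullet> x)"
        unfolding m_def
      proof (rule cSup_least)
        show "K \<noteq> {}" using \<open>- C \<in> K\<close> by blast
        fix k assume "k \<in> K"
        then have "k * (x \<bullet> x) \<le> x \<bullet> (B *\<^sub>v x)" using x unfolding K_def by blast
        then show "k \<le> x \<bullet> (B *\<^sub>v x) / (x \<bullet> x)" using pos by (simp add: pos_le_divide_eq)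
      qed
      then show ?thesis using pos by (simp add: field_simps)
    qed
  qed
  define S where "S = char_matrix B m"
  have S: "S \<in> carrier_mat p p" using B by (simp add: S_def)
  have S_eq: "S = B + (- m) \<cdot>\<^sub>m 1\<^sub>m p" using B by (simp add: S_def char_matrix_def)
  have form: "y \<bullet> (S *\<^sub>v y) = y \<bullet> (B *\<^sub>v y) - m * (y \<bullet> y)" if y: "y \<in> carrier_vec p" for y
  proof -
    have "S *\<^sub>v y = B *\<^sub>v y + (- m) \<cdot>\<^sub>v y"
      unfolding S_eq using B y by (subst add_mult_distrib_mat_vec[of _ p p]) auto
    then show ?thesis using B y by (simp add: scalar_prod_add_distrib[of _ p])
  qed
  have "transpose_mat S = S"
  proof -
    have "transpose_mat S = transpose_mat B + (- m) \<cdot>\<^sub>m 1\<^sub>m p"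
      unfolding S_eq using B by (intro eq_matI) auto
    then show ?thesis by (simp add: S_eq sym)
  qed
  have psd: "0 \<le> y \<bullet> (S *\<^sub>v y)" if "y \<in> carrier_vec p" for y
    using mK that form[OF that] by (simp add: K_def)
  \<comment> \<open>Were m not an eigenvalue, the form of S would be coercive and m could be increased.\<close>
  have "det S = 0"
  proof (rule ccontr)
    assume "det S \<noteq> 0"
    then obtain c where c: "c > 0" "\<And>y. y \<in> carrier_vec p \<Longrightarrow> c * (y \<bullet> y) \<le> y \<bullet> (S *\<^sub>v y)"
      using psd_form_coercive[OF S \<open>transpose_mat S = S\<close>] psd by blast
    have "m + c \<in> K"
      unfolding K_def
    proof (intro CollectI ballI)
      fix y :: "real vec" assume y: "y \<in> carrier_vec p"
      show "(m + c) * (y \<bullet> y) \<le> y \<bullet> (B *\<^sub>v y)"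
        using c(2)[OF y] form[OF y] by (simp add: algebra_simps)
    qed
    then have "m + c \<le> m" unfolding m_def by (rule cSup_upper[OF _ bdd])
    then show False using c(1) by simp
  qed
  then have ev: "eigenvalue B m" unfolding S_def eigenvalue_det[OF B] .
  have "char_poly B \<noteq> 0" using degree_monic_char_poly[OF B] by auto
  then have "finite {k. eigenvalue B k}"
    unfolding eigenvalue_root_char_poly[OF B] by (rule poly_roots_finite)
  then have "lambda_min B \<le> m" unfolding lambda_min_def using ev by (intro Min_le) auto
  then have "lambda_min B * (x \<bullet> x) \<le> m * (x \<bullet> x)" by (intro mult_right_mono nonneg x)
  also have "\<dots> \<le> x \<bullet> (B *\<^sub>v x)" using mK x by (simp add: K_def)
  finally show ?thesis .
qed

section \<open>Maximizing a separable convex penalty plus a quadratic form over the cube\<close>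

text \<open>Points of the cube are functions \<open>nat \<Rightarrow> real\<close> of which only the first \<open>p\<close> values matter: these carry
limits and measurability coordinatewise. The linear coefficients \<open>b\<close> are an argument of the objective,
not a parameter, because they are the only random part.\<close>

locale separable_problem =
  fixes p :: nat and a :: "nat \<Rightarrow> nat \<Rightarrow> real" and G :: "nat \<Rightarrow> real \<Rightarrow> ereal"
  assumes G_nonneg: "\<bar>u\<bar> \<le> 1 \<Longrightarrow> 0 \<le> G i u"
    and G_finite: "\<bar>u\<bar> < 1 \<Longrightarrow> G i u \<noteq> \<infinity>"
    and G_cont: "continuous_on {-1..1} (G i)"
begin

definition quad_part :: "(nat \<Rightarrow> real) \<Rightarrow> real" where
  "quad_part x = (\<Sum>i<p. \<Sum>j<p. a i j * x i * x j) / 2"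

definition objective :: "(nat \<Rightarrow> real) \<Rightarrow> (nat \<Rightarrow> real) \<Rightarrow> ereal" where
  "objective b x = ereal ((\<Sum>i<p. b i * x i) - quad_part x) - (\<Sum>i<p. G i (x i))"

definition sqdist :: "(nat \<Rightarrow> real) \<Rightarrow> (nat \<Rightarrow> real) \<Rightarrow> real" where
  "sqdist x y = (\<Sum>i<p. (x i - y i)\<^sup>2)"

definition unit_box :: "(nat \<Rightarrow> real) set" where
  "unit_box = {x. \<forall>i<p. \<bar>x i\<bar> \<le> 1}"

text \<open>Coordinates beyond \<open>p\<close> are set to 0, which makes the set countable; the interior of the cube is used
because the objective is finite there.\<close>

definition rational_grid :: "(nat \<Rightarrow> real) set" where
  "rational_grid = {x. (\<forall>i<p. x i \<in> \<rat> \<and> \<bar>x i\<bar> < 1) \<and> (\<forall>i\<ge>p. x i = 0)}"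

lemma countable_grid: "countable rational_grid"
proof -
  have "rational_grid \<subseteq> (\<lambda>f i. if i < p then f i else 0) ` (PiE {..<p} (\<lambda>_. \<rat>))"
  proof
    fix x assume x: "x \<in> rational_grid"
    have "x = (\<lambda>i. if i < p then restrict x {..<p} i else 0)"
      using x by (auto simp: rational_grid_def fun_eq_iff)
    moreover have "restrict x {..<p} \<in> PiE {..<p} (\<lambda>_. \<rat>)" using x by (auto simp: rational_grid_def)
    ultimately show "x \<in> (\<lambda>f i. if i < p then f i else 0) ` (PiE {..<p} (\<lambda>_. \<rat>))" by blast
  qed
  moreover have "countable (PiE {..<p} (\<lambda>_. \<rat> :: real set))"
    by (intro countable_PiE countable_rat) auto
  ultimately show ?thesis by (rule countable_subset[OF _ countable_image])
qed

lemma zero_in_rational_grid: "(\<lambda>_. 0) \<in> rational_grid" by (simp add: rational_grid_def)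

lemma grid_subset_box: "rational_grid \<subseteq> unit_box" by (auto simp: rational_grid_def unit_box_def less_imp_le)

lemma midpoint_in_rational_grid:
  assumes "x \<in> rational_grid" "y \<in> rational_grid"
  shows "(\<lambda>i. (1 - 1 / 2) * x i + 1 / 2 * y i) \<in> rational_grid"
  unfolding rational_grid_def
proof (intro CollectI conjI allI impI)
  fix i assume "i < p"
  then have i: "x i \<in> \<rat>" "\<bar>x i\<bar> < 1" "y i \<in> \<rat>" "\<bar>y i\<bar> < 1" using assms by (auto simp: rational_grid_def)
  then have "x i / 2 + y i / 2 \<in> \<rat>" by (intro Rats_add Rats_divide) auto
  then show "(1 - 1 / 2) * x i + 1 / 2 * y i \<in> \<rat>" by simp
  show "\<bar>(1 - 1 / 2) * x i + 1 / 2 * y i\<bar> < 1" using i by (auto simp: abs_less_iff)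
qed (use assms in \<open>auto simp: rational_grid_def\<close>)

lemma rational_grid_approximates:
  assumes x: "x \<in> unit_box"
  shows "\<exists>q. (\<forall>k. q k \<in> rational_grid) \<and> (\<forall>i<p. (\<lambda>k. q k i) \<longlonglongrightarrow> x i)"
proof -
  have "\<exists>r\<in>\<rat>. \<bar>r\<bar> < 1 \<and> \<bar>r - x i\<bar> < 1 / (real k + 1)" if i: "i < p" for i k
  proof -
    define h where "h = 1 / (real k + 1)"
    have h: "0 < h" by (simp add: h_def)
    have "\<bar>x i\<bar> \<le> 1" using x i by (simp add: unit_box_def)
    then have "max (- 1) (x i - h) < min 1 (x i + h)" using h by auto
    from Rats_dense_in_real[OF this] show ?thesis unfolding h_def[symmetric]
      by (force simp: abs_less_iff)
  qed
  then have "\<forall>k i. \<exists>r. i < p \<longrightarrow> r \<in> \<rat> \<and> \<bar>r\<bar> < 1 \<and> \<bar>r - x i\<bar> < 1 / (real k + 1)" by blast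
  then obtain r where r: "\<And>k i. i < p \<Longrightarrow> r k i \<in> \<rat> \<and> \<bar>r k i\<bar> < 1 \<and> \<bar>r k i - x i\<bar> < 1 / (real k + 1)"
    by metis
  define q where "q k i = (if i < p then r k i else 0)" for k i
  show ?thesis
  proof (intro exI conjI allI impI)
    show "q k \<in> rational_grid" for k using r by (simp add: rational_grid_def q_def)
    fix i assume i: "i < p"
    have "(\<lambda>k. q k i - x i) \<longlonglongrightarrow> 0"
    proof (rule Lim_null_comparison)
      show "\<forall>\<^sub>F k in sequentially. norm (q k i - x i) \<le> 1 / (real k + 1)"
        using r[OF i] i by (simp add: q_def less_imp_le)
      show "(\<lambda>k. 1 / (real k + 1)) \<longlonglongrightarrow> 0"
        using LIMSEQ_inverse_real_of_nat by (simp add: inverse_eq_divide add.commute)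
    qed
    then show "(\<lambda>k. q k i) \<longlonglongrightarrow> x i" by (rule LIM_zero_cancel)
  qed
qed

lemma sum_G_nonneg: "x \<in> unit_box \<Longrightarrow> 0 \<le> (\<Sum>i<p. G i (x i))"
  by (intro sum_nonneg G_nonneg) (auto simp: unit_box_def)

text \<open>The penalty is nonnegative, so its infinite values cause no cancellation.\<close>

lemma objective_tendsto:
  assumes q: "\<And>k. q k \<in> unit_box" and x: "x \<in> unit_box" and lim: "\<And>i. i < p \<Longrightarrow> (\<lambda>k. q k i) \<longlonglongrightarrow> x i"
  shows "(\<lambda>k. objective b (q k)) \<longlonglongrightarrow> objective b x"
proof -
  have G_lim: "(\<lambda>k. G i (q k i)) \<longlonglongrightarrow> G i (x i)" if i: "i < p" for i
    using q x i by (intro continuous_on_tendsto_compose[OF G_cont lim]) (auto simp: unit_box_def abs_le_iff)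
  have "m \<le> p \<Longrightarrow> (\<lambda>k. \<Sum>i<m. G i (q k i)) \<longlonglongrightarrow> (\<Sum>i<m. G i (x i))" for m
  proof (induction m)
    case (Suc m)
    have "0 \<le> (\<Sum>i<m. G i (x i))" "0 \<le> G m (x m)"
      using x Suc.prems by (auto intro!: sum_nonneg G_nonneg simp: unit_box_def)
    then show ?case
      using Suc G_lim[of m] by (auto intro!: tendsto_add_ereal_nonneg)
  qed simp
  then have S: "(\<lambda>k. \<Sum>i<p. G i (q k i)) \<longlonglongrightarrow> (\<Sum>i<p. G i (x i))" by simp
  have "(\<lambda>k. (\<Sum>i<p. b i * q k i) - quad_part (q k)) \<longlonglongrightarrow> (\<Sum>i<p. b i * x i) - quad_part x"
    unfolding quad_part_def by (intro tendsto_intros lim) auto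
  then have "(\<lambda>k. ereal ((\<Sum>i<p. b i * q k i) - quad_part (q k))) \<longlonglongrightarrow> ereal ((\<Sum>i<p. b i * x i) - quad_part x)"
    by simp
  from tendsto_diff_ereal_general[OF this S] show ?thesis unfolding objective_def by simp
qed

lemma objective_eq_real:
  assumes "\<And>i. i < p \<Longrightarrow> G i (x i) = ereal (g i)"
  shows "objective b x = ereal ((\<Sum>i<p. b i * x i) - quad_part x - (\<Sum>i<p. g i))"
  using assms by (simp add: objective_def)

lemma G_real:
  assumes "x \<in> unit_box" "i < p" "G i (x i) \<noteq> \<infinity>"
  shows "G i (x i) = ereal (real_of_ereal (G i (x i)))"
  using G_nonneg[of "x i" i] assms by (cases "G i (x i)") (auto simp: unit_box_def)

lemma objective_finite_imp_G_finite:
  assumes fin: "objective b x \<noteq> - \<infinity>" and i: "i < p"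
  shows "G i (x i) \<noteq> \<infinity>"
proof
  assume "G i (x i) = \<infinity>"
  then have "(\<Sum>j<p. G j (x j)) = \<infinity>" using i by (auto simp: sum_Pinfty)
  then show False using fin by (simp add: objective_def)
qed

lemma objective_le: "x \<in> unit_box \<Longrightarrow> objective b x \<le> ereal ((\<Sum>i<p. b i * x i) - quad_part x)"
  unfolding objective_def using sum_G_nonneg[of x] by (cases "\<Sum>i<p. G i (x i)") auto

lemma objective_grid_finite: "x \<in> rational_grid \<Longrightarrow> objective b x = ereal (real_of_ereal (objective b x))"
proof -
  assume x: "x \<in> rational_grid"
  then have "G i (x i) = ereal (real_of_ereal (G i (x i)))" if "i < p" for i
    using that G_real G_finite grid_subset_box by (auto simp: rational_grid_def)
  then show ?thesis using objective_eq_real[of x "\<lambda>i. real_of_ereal (G i (x i))" b] by simp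
qed

lemma linear_minus_quad_bounded:
  assumes "x \<in> unit_box"
  shows "(\<Sum>i<p. b i * x i) - quad_part x \<le> (\<Sum>i<p. \<bar>b i\<bar>) + (\<Sum>i<p. \<Sum>j<p. \<bar>a i j\<bar>) / 2"
proof -
  have ax: "\<bar>x i\<bar> \<le> 1" if "i < p" for i using assms that by (simp add: unit_box_def)
  have "b i * x i \<le> \<bar>b i\<bar>" if "i < p" for i
    using mult_left_mono[OF ax[OF that], of "\<bar>b i\<bar>"] abs_ge_self[of "b i * x i"] by (simp add: abs_mult)
  then have "(\<Sum>i<p. b i * x i) \<le> (\<Sum>i<p. \<bar>b i\<bar>)" by (intro sum_mono) auto
  moreover have "- (a i j * x i * x j) \<le> \<bar>a i j\<bar>" if "i < p" "j < p" for i j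
  proof -
    have "\<bar>x i\<bar> * \<bar>x j\<bar> \<le> 1" using ax[OF that(1)] ax[OF that(2)] by (simp add: mult_le_one)
    from mult_left_mono[OF this, of "\<bar>a i j\<bar>"] abs_ge_minus_self[of "a i j * x i * x j"]
    show ?thesis by (simp add: abs_mult mult.assoc)
  qed
  then have "(\<Sum>i<p. \<Sum>j<p. - (a i j * x i * x j)) \<le> (\<Sum>i<p. \<Sum>j<p. \<bar>a i j\<bar>)"
    by (intro sum_mono) auto
  then have "- quad_part x \<le> (\<Sum>i<p. \<Sum>j<p. \<bar>a i j\<bar>) / 2" by (simp add: quad_part_def sum_negf)
  ultimately show ?thesis by linarith
qed

lemma objective_not_PInf: "x \<in> unit_box \<Longrightarrow> objective b x \<noteq> \<infinity>"
  using objective_le[of x b] by auto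

lemma objective_cong: "(\<And>i. i < p \<Longrightarrow> x i = y i) \<Longrightarrow> objective b x = objective b y"
  unfolding objective_def quad_part_def by (auto intro!: arg_cong2[where f = minus] sum.cong)

lemma sqdist_cong: "(\<And>i. i < p \<Longrightarrow> x i = x' i) \<Longrightarrow> sqdist x y = sqdist x' y"
  unfolding sqdist_def by (auto intro!: sum.cong)

text \<open>Comparison with the origin, where the objective is finite, shows that it is finite at \<open>y\<close> too; only then
do the extended-real differences behave like real ones.\<close>

lemma quadratic_growth_imp_gap:
  assumes y: "y \<in> unit_box" and growth: "\<And>x. x \<in> unit_box \<Longrightarrow> ereal (\<kappa> * sqdist x y) \<le> objective b y - objective b x"
    and k: "0 < \<kappa>" and s: "0 < s" and x: "x \<in> unit_box" "c < sqdist x y"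
  shows "ereal s * (objective b x - objective b y) \<le> ereal (- (s * (\<kappa> * c)))"
proof -
  obtain r where r: "objective b y = ereal r"
  proof (cases "objective b y")
    case MInf
    have "objective b (\<lambda>_. 0) = ereal (real_of_ereal (objective b (\<lambda>_. 0)))" by (rule objective_grid_finite[OF zero_in_rational_grid])
    then have "objective b y - objective b (\<lambda>_. 0) = - \<infinity>" using MInf by (cases "objective b (\<lambda>_. 0)") auto
    moreover have "(\<lambda>_. 0) \<in> unit_box" by (simp add: unit_box_def)
    ultimately show ?thesis using growth by fastforce
  qed (use objective_not_PInf[OF y] in auto)
  show ?thesis
  proof (cases "objective b x")
    case (real q)
    have "\<kappa> * c \<le> \<kappa> * sqdist x y" using k x(2) by simp
    also have "\<dots> \<le> r - q" using growth[OF x(1)] r real by simp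
    finally have "s * (\<kappa> * c) \<le> s * (r - q)" using s by simp
    then show ?thesis using r real by (simp add: algebra_simps)
  next
    case MInf
    then show ?thesis using r s by simp
  qed (use objective_not_PInf[OF x(1)] in auto)
qed

lemma measurable_objective_point:
  assumes "x \<in> rational_grid" and b: "\<And>i. i < p \<Longrightarrow> (\<lambda>\<omega>. b \<omega> i) \<in> borel_measurable M"
  shows "(\<lambda>\<omega>. objective (b \<omega>) x) \<in> borel_measurable M"
proof -
  have "(\<lambda>\<omega>. (\<Sum>i<p. b \<omega> i * x i) - quad_part x) \<in> borel_measurable M"
    by (intro borel_measurable_diff borel_measurable_sum borel_measurable_times b) auto
  then show ?thesis unfolding objective_def by (intro borel_measurable_ereal_diff) auto
qed

text \<open>At a random point the penalty is measurable since it is continuous on \<open>[-1, 1]\<close>.\<close>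

lemma measurable_objective_random_point:
  assumes b: "\<And>i. i < p \<Longrightarrow> (\<lambda>\<omega>. b \<omega> i) \<in> borel_measurable M"
    and U: "\<And>i. i < p \<Longrightarrow> (\<lambda>\<omega>. U \<omega> i) \<in> borel_measurable M"
    and U_box: "\<And>\<omega>. \<omega> \<in> space M \<Longrightarrow> U \<omega> \<in> unit_box"
  shows "(\<lambda>\<omega>. objective (b \<omega>) (U \<omega>)) \<in> borel_measurable M"
proof -
  have "(\<lambda>\<omega>. G i (U \<omega> i)) \<in> borel_measurable M" if i: "i < p" for i
  proof -
    have "(\<lambda>\<omega>. U \<omega> i) \<in> measurable M (restrict_space borel {-1..1})"
      using U[OF i] U_box i by (intro measurable_restrict_space2) (force simp: unit_box_def abs_le_iff)+
    moreover have "G i \<in> borel_measurable (restrict_space borel {-1..1})"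
      by (rule borel_measurable_continuous_on_restrict[OF G_cont])
    ultimately show ?thesis by (rule measurable_compose)
  qed
  then have "(\<lambda>\<omega>. \<Sum>i<p. G i (U \<omega> i)) \<in> borel_measurable M" by (intro borel_measurable_ereal_sum) auto
  moreover have "(\<lambda>\<omega>. (\<Sum>i<p. b \<omega> i * U \<omega> i) - quad_part (U \<omega>)) \<in> borel_measurable M"
    unfolding quad_part_def
    by (intro borel_measurable_diff borel_measurable_sum borel_measurable_times borel_measurable_divide
        borel_measurable_const b U) auto
  ultimately show ?thesis unfolding objective_def by (intro borel_measurable_ereal_diff) auto
qed

text \<open>The far points form a relatively open set on which the objective is continuous, so rational points
suffice. If the objective is \<open>- \<infinity>\<close> at \<open>y\<close>, every difference is \<open>\<infinity>\<close> and the equality is about emptiness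
of the two sets.\<close>

lemma SUP_far_points_eq_rational_grid:
  fixes y :: "nat \<Rightarrow> real" and c s :: real
  assumes y: "y \<in> unit_box" and s: "0 < s"
  shows "(SUP x\<in>{x \<in> unit_box. c < sqdist x y}. ereal s * (objective b x - objective b y))
    = (SUP q\<in>rational_grid. if c < sqdist q y then ereal s * (objective b q - objective b y) else - \<infinity>)"
proof (rule antisym)
  let ?h = "\<lambda>q. if c < sqdist q y then ereal s * (objective b q - objective b y) else - \<infinity>"
  show "(SUP x\<in>{x \<in> unit_box. c < sqdist x y}. ereal s * (objective b x - objective b y)) \<le> (SUP q\<in>rational_grid. ?h q)"
  proof (rule SUP_least)
    fix x assume "x \<in> {x \<in> unit_box. c < sqdist x y}"
    then have x: "x \<in> unit_box" "c < sqdist x y" by auto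
    obtain q where q: "\<And>k. q k \<in> rational_grid" "\<And>i. i < p \<Longrightarrow> (\<lambda>k. q k i) \<longlonglongrightarrow> x i"
      using rational_grid_approximates[OF x(1)] by blast
    have "(\<lambda>k. sqdist (q k) y) \<longlonglongrightarrow> sqdist x y"
      unfolding sqdist_def by (intro tendsto_intros q) auto
    then have far: "\<forall>\<^sub>F k in sequentially. c < sqdist (q k) y" by (rule order_tendstoD(1)) (rule x)
    have ol: "(\<lambda>k. objective b (q k)) \<longlonglongrightarrow> objective b x"
      using q grid_subset_box by (intro objective_tendsto x) auto
    have "(\<lambda>k. objective b (q k) - objective b y) \<longlonglongrightarrow> objective b x - objective b y"
    proof (cases "objective b y")
      case (real r)
      then show ?thesis
        using tendsto_diff_ereal_general[OF ol tendsto_const[of "ereal r"]] by simp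
    next
      case MInf
      then show ?thesis by (simp add: minus_ereal_def)
    qed (use objective_not_PInf[OF y] in auto)
    then have "(\<lambda>k. ereal s * (objective b (q k) - objective b y)) \<longlonglongrightarrow> ereal s * (objective b x - objective b y)"
      by (intro tendsto_cmult_ereal) auto
    then show "ereal s * (objective b x - objective b y) \<le> (SUP q\<in>rational_grid. ?h q)"
    proof (rule tendsto_upperbound)
      show "\<forall>\<^sub>F k in sequentially. ereal s * (objective b (q k) - objective b y) \<le> (SUP q\<in>rational_grid. ?h q)"
        using far
      proof eventually_elim
        case (elim k)
        then show ?case by (intro SUP_upper2[of "q k"] q(1)) simp
      qed
    qed simp
  qed
  show "(SUP q\<in>rational_grid. ?h q) \<le> (SUP x\<in>{x \<in> unit_box. c < sqdist x y}. ereal s * (objective b x - objective b y))"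
    using grid_subset_box by (intro SUP_least) (auto intro!: SUP_upper)
qed

lemma measurable_SUP_far_points:
  fixes c s :: real
  assumes b: "\<And>i. i < p \<Longrightarrow> (\<lambda>\<omega>. b \<omega> i) \<in> borel_measurable M"
    and U: "\<And>i. i < p \<Longrightarrow> (\<lambda>\<omega>. U \<omega> i) \<in> borel_measurable M"
    and U_box: "\<And>\<omega>. \<omega> \<in> space M \<Longrightarrow> U \<omega> \<in> unit_box" and s: "0 < s"
  shows "(\<lambda>\<omega>. SUP x\<in>{x \<in> unit_box. c < sqdist x (U \<omega>)}. ereal s * (objective (b \<omega>) x - objective (b \<omega>) (U \<omega>)))
    \<in> borel_measurable M"
proof -
  have "(\<lambda>\<omega>. SUP q\<in>rational_grid. if c < sqdist q (U \<omega>) then ereal s * (objective (b \<omega>) q - objective (b \<omega>) (U \<omega>)) else - \<infinity>)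
      \<in> borel_measurable M"
  proof (intro borel_measurable_SUP countable_grid measurable_If)
    fix q assume q: "q \<in> rational_grid"
    show "(\<lambda>\<omega>. ereal s * (objective (b \<omega>) q - objective (b \<omega>) (U \<omega>))) \<in> borel_measurable M"
      by (intro borel_measurable_ereal_times borel_measurable_ereal_diff measurable_objective_point[OF q]
          measurable_objective_random_point b U U_box) auto
    have "(\<lambda>\<omega>. sqdist q (U \<omega>)) \<in> borel_measurable M"
      unfolding sqdist_def by (intro borel_measurable_sum borel_measurable_power borel_measurable_diff U) auto
    then show "{\<omega> \<in> space M. c < sqdist q (U \<omega>)} \<in> sets M" by measurable
  qed auto
  then show ?thesis
    by (rule measurable_cong[THEN iffD2, rotated]) (rule SUP_far_points_eq_rational_grid[OF U_box s])
qed

lemma quad_segment: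
  "quad_part (\<lambda>i. (1 - t) * x i + t * y i)
    = (1 - t) * quad_part x + t * quad_part y - t * (1 - t) * quad_part (\<lambda>i. x i - y i)"
proof -
  have *: "a i j * ((1 - t) * x i + t * y i) * ((1 - t) * x j + t * y j)
      = (1 - t) * (a i j * x i * x j) + t * (a i j * y i * y j)
        - t * (1 - t) * (a i j * (x i - y i) * (x j - y j))" for i j
    by (simp add: algebra_simps)
  show ?thesis unfolding quad_part_def *
    by (simp add: sum.distrib sum_subtractf flip: sum_distrib_left) 
qed

end

text \<open>The modulus \<open>k i\<close> of the \<open>i\<close>-th penalty and the quadratic form together dominate \<open>2 \<kappa>\<close> times the squared
length.\<close>

locale strongly_concave_problem = separable_problem +
  fixes k :: "nat \<Rightarrow> real" and \<kappa> :: real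
  assumes G_strongly_convex:
    "\<lbrakk>i < p; \<bar>u\<bar> \<le> 1; \<bar>v\<bar> \<le> 1; 0 \<le> t; t \<le> 1; G i u = ereal \<alpha>; G i v = ereal \<beta>\<rbrakk> \<Longrightarrow>
      G i ((1 - t) * u + t * v) \<le> ereal ((1 - t) * \<alpha> + t * \<beta> - k i / 2 * (t * (1 - t)) * (u - v)\<^sup>2)"
    and coercive: "2 * \<kappa> * (\<Sum>i<p. (x i)\<^sup>2) \<le> (\<Sum>i<p. \<Sum>j<p. a i j * x i * x j) + (\<Sum>i<p. k i * (x i)\<^sup>2)"
    and kappa_pos: "0 < \<kappa>"
begin

lemma segment_in_box:
  assumes "x \<in> unit_box" "y \<in> unit_box" "0 \<le> t" "t \<le> 1"
  shows "(\<lambda>i. (1 - t) * x i + t * y i) \<in> unit_box"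
  unfolding unit_box_def
proof (intro CollectI allI impI)
  fix i assume "i < p"
  then have "\<bar>x i\<bar> \<le> 1" "\<bar>y i\<bar> \<le> 1" using assms by (auto simp: unit_box_def)
  then have "\<bar>(1 - t) * x i\<bar> \<le> 1 - t" "\<bar>t * y i\<bar> \<le> t"
    using assms(3,4) by (auto simp: abs_mult mult_left_le)
  then show "\<bar>(1 - t) * x i + t * y i\<bar> \<le> 1" by linarith
qed

lemma objective_strongly_concave:
  assumes x: "x \<in> unit_box" "objective b x = ereal \<alpha>" and y: "y \<in> unit_box" "objective b y = ereal \<beta>"
    and t: "0 \<le> t" "t \<le> 1"
  shows "ereal ((1 - t) * \<alpha> + t * \<beta> + \<kappa> * (t * (1 - t)) * sqdist x y)
    \<le> objective b (\<lambda>i. (1 - t) * x i + t * y i)"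
proof -
  let ?w = "\<lambda>i. (1 - t) * x i + t * y i"
  define gx where "gx i = real_of_ereal (G i (x i))" for i
  define gy where "gy i = real_of_ereal (G i (y i))" for i
  define gw where "gw i = real_of_ereal (G i (?w i))" for i
  have w: "?w \<in> unit_box" by (rule segment_in_box[OF x(1) y(1) t])
  have gx: "G i (x i) = ereal (gx i)" if "i < p" for i
    unfolding gx_def using objective_finite_imp_G_finite[of b x i] x that by (intro G_real) auto
  have gy: "G i (y i) = ereal (gy i)" if "i < p" for i
    unfolding gy_def using objective_finite_imp_G_finite[of b y i] y that by (intro G_real) auto
  have Gw: "G i (?w i) \<le> ereal ((1 - t) * gx i + t * gy i - k i / 2 * (t * (1 - t)) * (x i - y i)\<^sup>2)"
    if "i < p" for i
    using x(1) y(1) that gx gy t by (intro G_strongly_convex) (auto simp: unit_box_def)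
  have gw: "G i (?w i) = ereal (gw i)" if i: "i < p" for i
  proof -
    have "G i (?w i) \<noteq> \<infinity>" using Gw[OF i] by auto
    then show ?thesis unfolding gw_def using G_real[OF w i] by simp
  qed
  let ?L = "\<lambda>x. \<Sum>i<p. b i * x i"
  have a: "\<alpha> = ?L x - quad_part x - sum gx {..<p}" using objective_eq_real[OF gx] x(2) by simp
  have b: "\<beta> = ?L y - quad_part y - sum gy {..<p}" using objective_eq_real[OF gy] y(2) by simp
  have L: "?L ?w = (1 - t) * ?L x + t * ?L y"
    by (simp add: sum_distrib_left sum.distrib[symmetric] algebra_simps)
  have "sum gw {..<p} \<le> (\<Sum>i<p. (1 - t) * gx i + t * gy i - k i / 2 * (t * (1 - t)) * (x i - y i)\<^sup>2)"
    using Gw gw by (intro sum_mono) auto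
  also have "\<dots> = (1 - t) * sum gx {..<p} + t * sum gy {..<p}
      - t * (1 - t) / 2 * (\<Sum>i<p. k i * (x i - y i)\<^sup>2)"
    by (simp add: sum.distrib sum_subtractf sum_distrib_left mult_ac)
  finally have S: "sum gw {..<p} \<le> \<dots>" .
  define T where "T = t * (1 - t)"
  have "T / 2 * (2 * \<kappa> * sqdist x y)
      \<le> T / 2 * (2 * quad_part (\<lambda>i. x i - y i) + (\<Sum>i<p. k i * (x i - y i)\<^sup>2))"
    using coercive[of "\<lambda>i. x i - y i"] t by (intro mult_left_mono) (auto simp: sqdist_def quad_part_def T_def)
  then have "\<kappa> * T * sqdist x y \<le> T * quad_part (\<lambda>i. x i - y i) + T / 2 * (\<Sum>i<p. k i * (x i - y i)\<^sup>2)"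
    by (simp add: field_simps)
  then have C: "\<kappa> * (t * (1 - t)) * sqdist x y \<le> t * (1 - t) * quad_part (\<lambda>i. x i - y i)
      + t * (1 - t) / 2 * (\<Sum>i<p. k i * (x i - y i)\<^sup>2)" by (simp only: T_def)
  have "(1 - t) * \<alpha> + t * \<beta> + \<kappa> * (t * (1 - t)) * sqdist x y \<le> ?L ?w - quad_part ?w - sum gw {..<p}"
  proof -
    have "(1 - t) * \<alpha> + t * \<beta> = ((1 - t) * ?L x + t * ?L y) - ((1 - t) * quad_part x + t * quad_part y)
        - ((1 - t) * sum gx {..<p} + t * sum gy {..<p})"
      unfolding a b by (simp add: algebra_simps)
    then show ?thesis unfolding L quad_segment using S C by linarith
  qed
  then show ?thesis using objective_eq_real[OF gw] by simp
qed

text \<open>Compare the maximum with points \<open>(1 - z) y + z x\<close> of the segment and let \<open>z\<close> tend to 1.\<close>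

lemma quadratic_growth_at_maximum:
  assumes x: "x \<in> unit_box" "objective b x = ereal s" and max: "\<And>y. y \<in> unit_box \<Longrightarrow> objective b y \<le> ereal s"
    and y: "y \<in> unit_box"
  shows "ereal (\<kappa> * sqdist y x) \<le> objective b x - objective b y"
proof (cases "objective b y")
  case (real \<beta>)
  have "\<kappa> * sqdist y x \<le> s - \<beta>"
  proof (rule field_le_mult_one_interval)
    fix z :: real assume z: "0 < z" "z < 1"
    have "ereal ((1 - z) * \<beta> + z * s + \<kappa> * (z * (1 - z)) * sqdist y x) \<le> ereal s"
      using objective_strongly_concave[OF y real x, of z] max[OF segment_in_box[OF y x(1), of z]] z
      by (meson less_imp_le order_trans)
    then have "(1 - z) * (z * (\<kappa> * sqdist y x)) \<le> (1 - z) * (s - \<beta>)" by (simp add: algebra_simps)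
    then show "z * (\<kappa> * sqdist y x) \<le> s - \<beta>" using z by simp
  qed
  then show ?thesis using real x by simp
next
  case MInf
  then show ?thesis using x by simp
qed (use objective_not_PInf[OF y] in auto)

text \<open>Among the rational points, take the first one in an enumeration whose value is within \<open>1 / (m + 1)\<close> of the
supremum; this choice is measurable. Strong concavity at midpoints makes the sequence Cauchy. Its limit is then
a pointwise limit of measurable maps, and by continuity it attains the supremum.\<close>

lemma measurable_maximizer:
  assumes b: "\<And>i. i < p \<Longrightarrow> (\<lambda>\<omega>. b \<omega> i) \<in> borel_measurable M"
  shows "\<exists>U. (\<forall>\<omega>. U \<omega> \<in> unit_box) \<and> (\<forall>i<p. (\<lambda>\<omega>. U \<omega> i) \<in> borel_measurable M) \<and>
    (\<forall>\<omega>. \<forall>y\<in>unit_box. ereal (\<kappa> * sqdist y (U \<omega>)) \<le> objective (b \<omega>) (U \<omega>) - objective (b \<omega>) y)"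
proof -
  define e where "e = from_nat_into rational_grid"
  have ne: "rational_grid \<noteq> {}" using zero_in_rational_grid by blast
  have range_e: "range e = rational_grid" unfolding e_def by (rule range_from_nat_into[OF ne countable_grid])
  then have e_grid: "e j \<in> rational_grid" for j by blast
  define f where "f \<omega> j = real_of_ereal (objective (b \<omega>) (e j))" for \<omega> j
  have objective_e: "objective (b \<omega>) (e j) = ereal (f \<omega> j)" for \<omega> j
    unfolding f_def by (rule objective_grid_finite[OF e_grid])
  have f_meas [measurable]: "(\<lambda>\<omega>. f \<omega> j) \<in> borel_measurable M" for j
    unfolding f_def by (intro borel_measurable_real_of_ereal measurable_objective_point e_grid b)
  have bdd: "bdd_above (range (f \<omega>))" for \<omega>
  proof (rule bdd_aboveI2)
    fix j
    have "ereal (f \<omega> j) \<le> ereal ((\<Sum>i<p. b \<omega> i * e j i) - quad_part (e j))"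
      unfolding objective_e[symmetric] using e_grid grid_subset_box by (intro objective_le) blast
    then show "f \<omega> j \<le> (\<Sum>i<p. \<bar>b \<omega> i\<bar>) + (\<Sum>i<p. \<Sum>j<p. \<bar>a i j\<bar>) / 2"
      using linear_minus_quad_bounded[of "e j" "b \<omega>"] e_grid grid_subset_box by force
  qed
  define S where "S \<omega> = (SUP j. f \<omega> j)" for \<omega>
  have S_meas [measurable]: "S \<in> borel_measurable M"
    unfolding S_def[abs_def] by (rule borel_measurable_cSUP) (use bdd in auto)
  have f_le: "f \<omega> j \<le> S \<omega>" for \<omega> j unfolding S_def by (rule cSUP_upper[OF _ bdd]) simp
  define J where "J m \<omega> = (LEAST j. S \<omega> - 1 / (real m + 1) < f \<omega> j)" for m \<omega>
  have J_meas: "J m \<in> measurable M (count_space UNIV)" for m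
    unfolding J_def[abs_def] by measurable
  have J: "S \<omega> - 1 / (real m + 1) < f \<omega> (J m \<omega>)" for m \<omega>
  proof -
    have "\<exists>j. S \<omega> - 1 / (real m + 1) < f \<omega> j"
      using less_cSUP_iff[of UNIV "f \<omega>" "S \<omega> - 1 / (real m + 1)"] bdd[of \<omega>]
      by (auto simp: S_def)
    then show ?thesis unfolding J_def by (rule LeastI_ex)
  qed
  define x where "x m \<omega> = e (J m \<omega>)" for m \<omega>
  have x_grid: "x m \<omega> \<in> rational_grid" for m \<omega> by (simp add: x_def e_grid)
  then have x_box: "x m \<omega> \<in> unit_box" for m \<omega> using grid_subset_box by blast
  have objective_x: "objective (b \<omega>) (x m \<omega>) = ereal (f \<omega> (J m \<omega>))" for m \<omega> by (simp add: x_def objective_e)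
  have close: "\<kappa> / 4 * (x m \<omega> i - x n \<omega> i)\<^sup>2 \<le> (1 / (real m + 1) + 1 / (real n + 1)) / 2"
    if i: "i < p" for m n i \<omega>
  proof -
    let ?w = "\<lambda>i. (1 - 1 / 2) * x m \<omega> i + 1 / 2 * x n \<omega> i"
    obtain j where j: "?w = e j" using midpoint_in_rational_grid[OF x_grid x_grid] range_e by (metis imageE)
    have avg: "s' - (u + v) / 2 \<le> (c + d) / 2" if "s' - c < u" "s' - d < v" for s' c d u v :: real
      using that by (simp add: field_simps)
    have "ereal ((1 - 1 / 2) * f \<omega> (J m \<omega>) + 1 / 2 * f \<omega> (J n \<omega>)
        + \<kappa> * (1 / 2 * (1 - 1 / 2)) * sqdist (x m \<omega>) (x n \<omega>)) \<le> objective (b \<omega>) ?w"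
      by (intro objective_strongly_concave x_box objective_x) auto
    also have "\<dots> \<le> ereal (S \<omega>)" unfolding j objective_e using f_le by simp
    finally have "\<kappa> / 4 * sqdist (x m \<omega>) (x n \<omega>) \<le> S \<omega> - (f \<omega> (J m \<omega>) + f \<omega> (J n \<omega>)) / 2"
      by (simp add: field_simps)
    also have "\<dots> \<le> (1 / (real m + 1) + 1 / (real n + 1)) / 2" by (rule avg[OF J J])
    finally have 1: "\<kappa> / 4 * sqdist (x m \<omega>) (x n \<omega>) \<le> (1 / (real m + 1) + 1 / (real n + 1)) / 2" .
    have "(x m \<omega> i - x n \<omega> i)\<^sup>2 \<le> sqdist (x m \<omega>) (x n \<omega>)"
      unfolding sqdist_def by (rule member_le_sum) (use i in auto)
    then have "\<kappa> / 4 * (x m \<omega> i - x n \<omega> i)\<^sup>2 \<le> \<kappa> / 4 * sqdist (x m \<omega>) (x n \<omega>)"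
      using kappa_pos by (intro mult_left_mono) auto
    with 1 show ?thesis by linarith
  qed
  have cauchy: "Cauchy (\<lambda>m. x m \<omega> i)" if i: "i < p" for \<omega> i
  proof (rule metric_CauchyI)
    fix \<epsilon> :: real assume \<epsilon>: "0 < \<epsilon>"
    have pos: "0 < \<kappa> / 4 * \<epsilon>\<^sup>2" using kappa_pos \<epsilon> by simp
    obtain N where N: "1 / (real N + 1) < \<kappa> / 4 * \<epsilon>\<^sup>2"
      using reals_Archimedean[OF pos] by (auto simp: inverse_eq_divide add.commute)
    have below: "c < w" if "c \<le> (u + v) / 2" "u \<le> r" "v \<le> r" "r < w" for c u v r w :: real
      using that by simp
    show "\<exists>N. \<forall>m\<ge>N. \<forall>n\<ge>N. dist (x m \<omega> i) (x n \<omega> i) < \<epsilon>"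
    proof (intro exI allI impI)
      fix m n assume "N \<le> m" "N \<le> n"
      then have "1 / (real m + 1) \<le> 1 / (real N + 1)" "1 / (real n + 1) \<le> 1 / (real N + 1)"
        by (auto intro!: divide_left_mono)
      then have "\<kappa> / 4 * (x m \<omega> i - x n \<omega> i)\<^sup>2 < \<kappa> / 4 * \<epsilon>\<^sup>2"
        by (intro below[OF close[OF i] _ _ N])
      then have "(x m \<omega> i - x n \<omega> i)\<^sup>2 < \<epsilon>\<^sup>2" using kappa_pos by simp
      then have "\<bar>x m \<omega> i - x n \<omega> i\<bar> < \<epsilon>" using \<epsilon> abs_le_square_iff[of \<epsilon> "x m \<omega> i - x n \<omega> i"] by force
      then show "dist (x m \<omega> i) (x n \<omega> i) < \<epsilon>" by (simp add: dist_real_def)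
    qed
  qed
  define U where "U \<omega> i = lim (\<lambda>m. x m \<omega> i)" for \<omega> i
  have U_lim: "(\<lambda>m. x m \<omega> i) \<longlonglongrightarrow> U \<omega> i" if "i < p" for \<omega> i
    unfolding U_def using cauchy[OF that] by (simp add: Cauchy_convergent_iff convergent_LIMSEQ_iff)
  have U_box: "U \<omega> \<in> unit_box" for \<omega>
    unfolding unit_box_def
  proof (intro CollectI allI impI)
    fix i assume i: "i < p"
    show "\<bar>U \<omega> i\<bar> \<le> 1"
      by (rule LIMSEQ_le_const2[OF tendsto_rabs[OF U_lim[OF i]]]) (use x_box i in \<open>auto simp: unit_box_def\<close>)
  qed
  have objective_U: "objective (b \<omega>) (U \<omega>) = ereal (S \<omega>)" for \<omega>
  proof (rule LIMSEQ_unique)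
    show "(\<lambda>m. objective (b \<omega>) (x m \<omega>)) \<longlonglongrightarrow> objective (b \<omega>) (U \<omega>)" by (rule objective_tendsto[OF x_box U_box U_lim])
    have "(\<lambda>m. f \<omega> (J m \<omega>)) \<longlonglongrightarrow> S \<omega>"
    proof (rule real_tendsto_sandwich)
      show "\<forall>\<^sub>F m in sequentially. S \<omega> - 1 / (real m + 1) \<le> f \<omega> (J m \<omega>)"
        using J by (simp add: less_imp_le)
      show "(\<lambda>m. S \<omega> - 1 / (real m + 1)) \<longlonglongrightarrow> S \<omega>"
        using tendsto_diff[OF tendsto_const[of "S \<omega>"] LIMSEQ_inverse_real_of_nat]
        by (simp add: inverse_eq_divide add.commute)
    qed (use f_le in auto)
    then show "(\<lambda>m. objective (b \<omega>) (x m \<omega>)) \<longlonglongrightarrow> ereal (S \<omega>)" unfolding objective_x by simp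
  qed
  have max: "objective (b \<omega>) y \<le> ereal (S \<omega>)" if y: "y \<in> unit_box" for \<omega> y
  proof -
    obtain q where q: "\<And>k. q k \<in> rational_grid" "\<And>i. i < p \<Longrightarrow> (\<lambda>k. q k i) \<longlonglongrightarrow> y i"
      using rational_grid_approximates[OF y] by blast
    have "(\<lambda>k. objective (b \<omega>) (q k)) \<longlonglongrightarrow> objective (b \<omega>) y"
      using q grid_subset_box by (intro objective_tendsto y) auto
    moreover have "objective (b \<omega>) (q k) \<le> ereal (S \<omega>)" for k
    proof -
      obtain j where "q k = e j" using q(1)[of k] range_e by (metis imageE)
      then show ?thesis using f_le by (simp add: objective_e)
    qed
    ultimately show ?thesis by (intro LIMSEQ_le_const2) auto
  qed
  show ?thesis
  proof (intro exI conjI allI impI ballI)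
    show "U \<omega> \<in> unit_box" for \<omega> by (rule U_box)
    show "(\<lambda>\<omega>. U \<omega> i) \<in> borel_measurable M" if i: "i < p" for i
    proof (rule borel_measurable_LIMSEQ_metric)
      show "(\<lambda>\<omega>. x m \<omega> i) \<in> borel_measurable M" for m
        unfolding x_def by (rule measurable_compose[OF J_meas]) simp
      show "(\<lambda>m. x m \<omega> i) \<longlonglongrightarrow> U \<omega> i" for \<omega> by (rule U_lim[OF i])
    qed
    show "ereal (\<kappa> * sqdist y (U \<omega>)) \<le> objective (b \<omega>) (U \<omega>) - objective (b \<omega>) y" if "y \<in> unit_box" for \<omega> y
      by (rule quadratic_growth_at_maximum[OF U_box objective_U max that])
  qed
qed

end

section \<open>The mean-field objective\<close>

text \<open>The three ingredients that turn \<open>mf_obj\<close> into the objective of a separable problem.\<close>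

definition coupling :: "real \<Rightarrow> real mat \<Rightarrow> nat \<Rightarrow> nat \<Rightarrow> real" where
  "coupling \<sigma> X i j = off_diag (gram X) $$ (i, j) / \<sigma>\<^sup>2"

definition site_field :: "real \<Rightarrow> real mat \<Rightarrow> real vec \<Rightarrow> nat \<Rightarrow> real" where
  "site_field \<sigma> X y i = (transpose_mat X *\<^sub>v y) $ i / \<sigma>\<^sup>2"

definition site_rate :: "real measure \<Rightarrow> real \<Rightarrow> real mat \<Rightarrow> nat \<Rightarrow> real \<Rightarrow> ereal" where
  "site_rate \<pi> \<sigma> X i u = rate_G \<pi> u (gram X $$ (i, i) / \<sigma>\<^sup>2)"

lemma gram_carrier: "X \<in> carrier_mat n p \<Longrightarrow> gram X \<in> carrier_mat p p"
  by (simp add: gram_def)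

lemma gram_symmetric: "X \<in> carrier_mat n p \<Longrightarrow> transpose_mat (gram X) = gram X"
  unfolding gram_def by (subst transpose_mult[of _ p n]) auto

lemma gram_diag_nonneg: "X \<in> carrier_mat n p \<Longrightarrow> i < p \<Longrightarrow> 0 \<le> gram X $$ (i, i)"
  unfolding gram_def by (auto simp: scalar_prod_def intro!: sum_nonneg)

lemma coupling_diag: "X \<in> carrier_mat n p \<Longrightarrow> i < p \<Longrightarrow> coupling \<sigma> X i i = 0"
  using gram_carrier[of X n p] by (simp add: coupling_def off_diag_def)

lemma coupling_off_diag:
  "X \<in> carrier_mat n p \<Longrightarrow> i < p \<Longrightarrow> j < p \<Longrightarrow> i \<noteq> j \<Longrightarrow> coupling \<sigma> X i j = gram X $$ (i, j) / \<sigma>\<^sup>2"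
  using gram_carrier[of X n p] by (simp add: coupling_def off_diag_def)

lemma coupling_symmetric:
  assumes "X \<in> carrier_mat n p" "i < p" "j < p"
  shows "coupling \<sigma> X i j = coupling \<sigma> X j i"
proof -
  have "gram X $$ (i, j) = gram X $$ (j, i)"
    using gram_symmetric[OF assms(1)] gram_carrier[OF assms(1)] assms(2,3)
    by (metis carrier_matD index_transpose_mat(1))
  then show ?thesis using assms by (cases "i = j") (auto simp: coupling_off_diag[OF assms(1)])
qed

context cube_prior begin

lemma separable_problem_mf: "separable_problem (site_rate \<pi> \<sigma> X)"
  by unfold_locales (auto simp: site_rate_def[abs_def] rate_G_nonneg rate_G_interior continuous_on_rate_G)

lemma mf_obj_eq:
  assumes X: "X \<in> carrier_mat n p" and y: "y \<in> carrier_vec n" and u: "u \<in> carrier_vec p"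
    and s: "0 < \<sigma>"
  shows "mf_obj \<sigma> \<pi> X y u
    = separable_problem.objective p (coupling \<sigma> X) (site_rate \<pi> \<sigma> X) (site_field \<sigma> X y) (\<lambda>i. u $ i)"
proof -
  interpret separable_problem p "coupling \<sigma> X" "site_rate \<pi> \<sigma> X" by (rule separable_problem_mf)
  have off: "off_diag (gram X) \<in> carrier_mat p p" using gram_carrier[OF X] by (simp add: off_diag_def)
  define z where "z = transpose_mat X *\<^sub>v y"
  have z: "z \<in> carrier_vec p" using X y by (simp add: z_def)
  have "z \<bullet> u = (\<Sum>i<p. z $ i * u $ i)"
    using u by (auto simp: scalar_prod_def lessThan_atLeast0)
  then have lin: "(\<Sum>i<p. site_field \<sigma> X y i * u $ i) = (z \<bullet> u) / \<sigma>\<^sup>2"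
    by (simp add: site_field_def z_def sum_divide_distrib)
  have q: "quad_part (\<lambda>i. u $ i) = (u \<bullet> (off_diag (gram X) *\<^sub>v u)) / \<sigma>\<^sup>2 / 2"
    unfolding scalar_prod_mult_mat_vec_sum[OF off u u] quad_part_def coupling_def
    by (simp add: sum_divide_distrib)
  have "- 1 / (2 * \<sigma>\<^sup>2) * (u \<bullet> (off_diag (gram X) *\<^sub>v u) - 2 * (z \<bullet> u))
      = (\<Sum>i<p. site_field \<sigma> X y i * u $ i) - quad_part (\<lambda>i. u $ i)"
    unfolding lin q using s by (simp add: field_simps)
  then show ?thesis using X
    by (simp add: mf_obj_def objective_def Let_def site_rate_def z_def[symmetric])
qed

end

lemma sq_dist_eq:
  assumes "u \<in> carrier_vec p" "v \<in> carrier_vec p"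
  shows "sq_dist u v = (\<Sum>i<p. (u $ i - v $ i)\<^sup>2)"
  using assms by (auto simp: sq_dist_def scalar_prod_def lessThan_atLeast0 power2_eq_square)

lemma measurable_site_field:
  assumes X: "X \<in> carrier_mat n p" and Y: "gaussian_vec M Y n \<mu> \<sigma>" and i: "i < p"
  shows "(\<lambda>\<omega>. site_field \<sigma>' X (Y \<omega>) i) \<in> borel_measurable M"
proof -
  have Yc: "Y \<omega> \<in> carrier_vec n" if "\<omega> \<in> space M" for \<omega>
    using Y that by (simp add: gaussian_vec_def)
  have m: "(\<lambda>\<omega>. \<lambda>i\<in>{..<n}. Y \<omega> $ i) \<in> measurable M (Pi\<^sub>M {..<n} (\<lambda>_. lborel))"
    using Y by (auto simp: gaussian_vec_def distributed_def)
  have comp: "(\<lambda>\<omega>. Y \<omega> $ j) \<in> borel_measurable M" if "j < n" for j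
    using measurable_compose[OF m measurable_component_singleton[of j "{..<n}"]] that by simp
  have "(\<lambda>\<omega>. (\<Sum>j<n. X $$ (j, i) * Y \<omega> $ j) / \<sigma>'\<^sup>2) \<in> borel_measurable M"
    by (intro borel_measurable_divide borel_measurable_sum borel_measurable_times
        borel_measurable_const comp) auto
  moreover have "site_field \<sigma>' X (Y \<omega>) i = (\<Sum>j<n. X $$ (j, i) * Y \<omega> $ j) / \<sigma>'\<^sup>2" if "\<omega> \<in> space M" for \<omega>
    using X Yc[OF that] i by (auto simp: site_field_def scalar_prod_def lessThan_atLeast0)
  ultimately show ?thesis by (subst measurable_cong) auto
qed

text \<open>By \<open>2 \<bar>x\<^sub>i x\<^sub>j\<bar> \<le> x\<^sub>i\<^sup>2 + x\<^sub>j\<^sup>2\<close> and symmetry the form is at least \<open>- r\<close> times the squared length.\<close>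

lemma coercive_diagonally_dominant:
  fixes c :: "nat \<Rightarrow> nat \<Rightarrow> real"
  assumes sym: "\<And>i j. i < p \<Longrightarrow> j < p \<Longrightarrow> c i j = c j i"
    and row: "\<And>i. i < p \<Longrightarrow> (\<Sum>j<p. \<bar>c i j\<bar>) \<le> r"
  shows "(1 - r) * (\<Sum>i<p. (x i)\<^sup>2) \<le> (\<Sum>i<p. \<Sum>j<p. c i j * x i * x j) + (\<Sum>i<p. (x i)\<^sup>2)"
proof -
  have "(\<Sum>i<p. \<Sum>j<p. \<bar>c i j\<bar> * (x j)\<^sup>2) = (\<Sum>i<p. \<Sum>j<p. \<bar>c i j\<bar> * (x i)\<^sup>2)"
    by (subst sum.swap) (auto intro!: sum.cong simp: sym)
  then have "(\<Sum>i<p. \<Sum>j<p. \<bar>c i j\<bar> * ((x i)\<^sup>2 + (x j)\<^sup>2) / 2) = (\<Sum>i<p. \<Sum>j<p. \<bar>c i j\<bar> * (x i)\<^sup>2)"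
    by (simp add: distrib_left add_divide_distrib sum.distrib flip: sum_divide_distrib)
  also have "\<dots> = (\<Sum>i<p. (\<Sum>j<p. \<bar>c i j\<bar>) * (x i)\<^sup>2)" by (simp add: sum_distrib_right)
  also have "\<dots> \<le> (\<Sum>i<p. r * (x i)\<^sup>2)" by (intro sum_mono mult_right_mono row) auto
  finally have "\<bar>\<Sum>i<p. \<Sum>j<p. c i j * x i * x j\<bar> \<le> r * (\<Sum>i<p. (x i)\<^sup>2)"
    using sum_quadratic_form_le[of c x p] by (simp add: sum_distrib_left)
  then show ?thesis by (simp add: algebra_simps abs_le_iff)
qed

text \<open>The diagonal moduli complete the off-diagonal couplings to the Gram matrix.\<close>

lemma coercive_lambda_min:
  assumes X: "X \<in> carrier_mat n p" and p: "0 < p" and l: "l \<le> lambda_min (gram X)" and s: "0 < \<sigma>"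
  shows "l / \<sigma>\<^sup>2 * (\<Sum>i<p. (x i)\<^sup>2)
    \<le> (\<Sum>i<p. \<Sum>j<p. coupling \<sigma> X i j * x i * x j) + (\<Sum>i<p. gram X $$ (i, i) / \<sigma>\<^sup>2 * (x i)\<^sup>2)"
proof -
  define v where "v = vec p x"
  have v: "v \<in> carrier_vec p" "\<And>i. i < p \<Longrightarrow> v $ i = x i" by (auto simp: v_def)
  have vv: "v \<bullet> v = (\<Sum>i<p. (x i)\<^sup>2)"
    using v by (auto simp: scalar_prod_def lessThan_atLeast0 power2_eq_square)
  have "l * (v \<bullet> v) \<le> lambda_min (gram X) * (v \<bullet> v)"
    by (intro mult_right_mono l) (simp add: vv sum_nonneg)
  also have "\<dots> \<le> v \<bullet> (gram X *\<^sub>v v)"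
    by (rule lambda_min_le_quadratic_form[OF gram_carrier[OF X] gram_symmetric[OF X] p v(1)])
  also have "\<dots> = (\<Sum>i<p. \<Sum>j<p. gram X $$ (i, j) * x i * x j)"
    unfolding scalar_prod_mult_mat_vec_sum[OF gram_carrier[OF X] v(1) v(1)] by (simp add: v)
  finally have "l / \<sigma>\<^sup>2 * (\<Sum>i<p. (x i)\<^sup>2) \<le> (\<Sum>i<p. \<Sum>j<p. gram X $$ (i, j) * x i * x j) / \<sigma>\<^sup>2"
    using s by (simp add: vv divide_right_mono)
  also have "\<dots> = (\<Sum>i<p. (\<Sum>j<p. gram X $$ (i, j) / \<sigma>\<^sup>2 * x i * x j))"
    by (simp add: sum_divide_distrib)
  also have "\<dots> = (\<Sum>i<p. (\<Sum>j<p. coupling \<sigma> X i j * x i * x j) + gram X $$ (i, i) / \<sigma>\<^sup>2 * (x i)\<^sup>2)"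
  proof (rule sum.cong[OF refl])
    fix i assume "i \<in> {..<p}"
    then have i: "i < p" by simp
    have "(\<Sum>j<p. gram X $$ (i, j) / \<sigma>\<^sup>2 * x i * x j)
        = (\<Sum>j<p. coupling \<sigma> X i j * x i * x j + (if j = i then gram X $$ (i, i) / \<sigma>\<^sup>2 * (x i)\<^sup>2 else 0))"
      using i X
      by (intro sum.cong refl) (auto simp: coupling_off_diag coupling_diag power2_eq_square)
    then show "(\<Sum>j<p. gram X $$ (i, j) / \<sigma>\<^sup>2 * x i * x j)
        = (\<Sum>j<p. coupling \<sigma> X i j * x i * x j) + gram X $$ (i, i) / \<sigma>\<^sup>2 * (x i)\<^sup>2"
      using i by (simp add: sum.distrib)
  qed
  finally show ?thesis by (simp add: sum.distrib)
qed

context cube_prior begin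

lemma strongly_concave_diagonally_dominant:
  assumes X: "X \<in> carrier_mat n p" and s: "0 < \<sigma>" and L: "L < \<sigma>\<^sup>2"
    and row: "\<And>i. i < p \<Longrightarrow> (\<Sum>j\<in>{..<p} - {i}. \<bar>off_diag (gram X) $$ (i, j)\<bar>) \<le> L"
  shows "strongly_concave_problem p (coupling \<sigma> X) (site_rate \<pi> \<sigma> X) (\<lambda>_. 1) ((1 - L / \<sigma>\<^sup>2) / 2)"
proof -
  interpret separable_problem p "coupling \<sigma> X" "site_rate \<pi> \<sigma> X" by (rule separable_problem_mf)
  have row': "(\<Sum>j<p. \<bar>coupling \<sigma> X i j\<bar>) \<le> L / \<sigma>\<^sup>2" if i: "i < p" for i
  proof -
    have "(\<Sum>j<p. \<bar>coupling \<sigma> X i j\<bar>) = (\<Sum>j\<in>{..<p} - {i}. \<bar>coupling \<sigma> X i j\<bar>)"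
      using i coupling_diag[OF X i] by (subst sum.remove[of _ i]) auto
    also have "\<dots> = (\<Sum>j\<in>{..<p} - {i}. \<bar>off_diag (gram X) $$ (i, j)\<bar>) / \<sigma>\<^sup>2"
      by (simp add: coupling_def sum_divide_distrib)
    also have "\<dots> \<le> L / \<sigma>\<^sup>2" by (intro divide_right_mono row i) simp
    finally show ?thesis .
  qed
  show ?thesis
  proof
    show "2 * ((1 - L / \<sigma>\<^sup>2) / 2) * (\<Sum>i<p. (x i)\<^sup>2)
        \<le> (\<Sum>i<p. \<Sum>j<p. coupling \<sigma> X i j * x i * x j) + (\<Sum>i<p. 1 * (x i)\<^sup>2)" for x
    proof -
      have half: "2 * ((1 - L / \<sigma>\<^sup>2) / 2) = 1 - L / \<sigma>\<^sup>2" by simp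
      show ?thesis unfolding half mult_1_left
        by (rule coercive_diagonally_dominant[OF coupling_symmetric[OF X] row'])
    qed
    show "0 < (1 - L / \<sigma>\<^sup>2) / 2" using L s by (simp add: field_simps)
  next
    fix i and u v t \<alpha> \<beta> :: real
    assume "\<bar>u\<bar> \<le> 1" "\<bar>v\<bar> \<le> 1" "0 \<le> t" "t \<le> 1"
      "site_rate \<pi> \<sigma> X i u = ereal \<alpha>" "site_rate \<pi> \<sigma> X i v = ereal \<beta>"
    then show "site_rate \<pi> \<sigma> X i ((1 - t) * u + t * v)
        \<le> ereal ((1 - t) * \<alpha> + t * \<beta> - 1 / 2 * (t * (1 - t)) * (u - v)\<^sup>2)"
      unfolding site_rate_def by (intro rate_G_strongly_convex) (auto simp: tilted_var_le_one)
  qed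
qed

lemma strongly_concave_log_concave_prior:
  assumes X: "X \<in> carrier_mat n p" and s: "0 < \<sigma>" and p: "0 < p"
    and l: "0 < l" "l \<le> lambda_min (gram X)"
    and tilted_var: "\<And>d s. 0 \<le> d \<Longrightarrow> d * tilted_var d s \<le> 1"
  shows "strongly_concave_problem p (coupling \<sigma> X) (site_rate \<pi> \<sigma> X)
    (\<lambda>i. gram X $$ (i, i) / \<sigma>\<^sup>2) (l / \<sigma>\<^sup>2 / 2)"
proof -
  interpret separable_problem p "coupling \<sigma> X" "site_rate \<pi> \<sigma> X" by (rule separable_problem_mf)
  show ?thesis
  proof
    show "2 * (l / \<sigma>\<^sup>2 / 2) * (\<Sum>i<p. (x i)\<^sup>2)
        \<le> (\<Sum>i<p. \<Sum>j<p. coupling \<sigma> X i j * x i * x j) + (\<Sum>i<p. gram X $$ (i, i) / \<sigma>\<^sup>2 * (x i)\<^sup>2)" for x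
      using coercive_lambda_min[OF X p l(2) s, of x] by simp
    show "0 < l / \<sigma>\<^sup>2 / 2" using l s by simp
  next
    fix i and u v t \<alpha> \<beta> :: real
    assume "i < p" and *: "\<bar>u\<bar> \<le> 1" "\<bar>v\<bar> \<le> 1" "0 \<le> t" "t \<le> 1"
      "site_rate \<pi> \<sigma> X i u = ereal \<alpha>" "site_rate \<pi> \<sigma> X i v = ereal \<beta>"
    have "0 \<le> gram X $$ (i, i) / \<sigma>\<^sup>2" using gram_diag_nonneg[OF X \<open>i < p\<close>] by simp
    then show "site_rate \<pi> \<sigma> X i ((1 - t) * u + t * v)
        \<le> ereal ((1 - t) * \<alpha> + t * \<beta> - gram X $$ (i, i) / \<sigma>\<^sup>2 / 2 * (t * (1 - t)) * (u - v)\<^sup>2)"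
      using * unfolding site_rate_def by (intro rate_G_strongly_convex tilted_var) auto
  qed
qed

lemma growing_random_maximizer:
  assumes X: "X \<in> carrier_mat n p" and s: "0 < \<sigma>" and Y: "gaussian_vec M Y n \<mu> \<sigma>"
    and conc: "strongly_concave_problem p (coupling \<sigma> X) (site_rate \<pi> \<sigma> X) k \<kappa>"
  shows "\<exists>U. random_cube_point M p U \<and> (\<forall>\<omega>\<in>space M. \<forall>u\<in>cube p.
    ereal (\<kappa> * sq_dist u (U \<omega>)) \<le> mf_obj \<sigma> \<pi> X (Y \<omega>) (U \<omega>) - mf_obj \<sigma> \<pi> X (Y \<omega>) u)"
proof -
  interpret strongly_concave_problem p "coupling \<sigma> X" "site_rate \<pi> \<sigma> X" k \<kappa> by (rule conc)
  obtain U where U': "(\<forall>\<omega>. U \<omega> \<in> unit_box) \<and> (\<forall>i<p. (\<lambda>\<omega>. U \<omega> i) \<in> borel_measurable M) \<and>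
    (\<forall>\<omega>. \<forall>y\<in>unit_box. ereal (\<kappa> * sqdist y (U \<omega>))
      \<le> objective (site_field \<sigma> X (Y \<omega>)) (U \<omega>) - objective (site_field \<sigma> X (Y \<omega>)) y)"
    using measurable_maximizer[of "\<lambda>\<omega>. site_field \<sigma> X (Y \<omega>)" M, OF measurable_site_field[OF X Y]]
    by (rule exE)
  note U = U'[THEN conjunct1] U'[THEN conjunct2, THEN conjunct1] U'[THEN conjunct2, THEN conjunct2]
  let ?U = "\<lambda>\<omega>. vec p (U \<omega>)"
  have "random_cube_point M p ?U"
    using U(1,2) by (force simp: random_cube_point_def cube_def unit_box_def abs_le_iff)
  moreover have "ereal (\<kappa> * sq_dist u (?U \<omega>)) \<le> mf_obj \<sigma> \<pi> X (Y \<omega>) (?U \<omega>) - mf_obj \<sigma> \<pi> X (Y \<omega>) u"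
    if \<omega>: "\<omega> \<in> space M" and u: "u \<in> cube p" for \<omega> u
  proof -
    have y: "Y \<omega> \<in> carrier_vec n" using Y \<omega> by (simp add: gaussian_vec_def)
    have uc: "u \<in> carrier_vec p" and ub: "(\<lambda>i. u $ i) \<in> unit_box"
      using u by (auto simp: cube_def unit_box_def abs_le_iff)
    have "mf_obj \<sigma> \<pi> X (Y \<omega>) (?U \<omega>) = objective (site_field \<sigma> X (Y \<omega>)) (U \<omega>)"
      using mf_obj_eq[OF X y _ s, of "?U \<omega>"] objective_cong[of "\<lambda>i. ?U \<omega> $ i" "U \<omega>"] by simp
    moreover have "sq_dist u (?U \<omega>) = sqdist (\<lambda>i. u $ i) (U \<omega>)"
      using sq_dist_eq[OF uc, of "?U \<omega>"] by (simp add: sqdist_def)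
    ultimately show ?thesis using bspec[OF spec[OF U(3)] ub, of \<omega>] mf_obj_eq[OF X y uc s] by simp
  qed
  ultimately show ?thesis by (intro exI[of _ ?U]) auto
qed

text \<open>Quadratic growth forces the gap at all far points, so the first event lies in the second. The second is
measurable; the first may not be, and its measure is then 0 by default.\<close>

lemma separation_event_lower_bound:
  assumes X: "X \<in> carrier_mat n p" and s: "0 < \<sigma>" and Y: "gaussian_vec M Y n \<mu> \<sigma>"
    and M: "prob_space M" and U: "random_cube_point M p U" and p: "0 < p" and k: "0 < \<kappa>" and e: "0 < \<epsilon>"
  shows "measure M {\<omega> \<in> space M. \<forall>u\<in>cube p.
        mf_obj \<sigma> \<pi> X (Y \<omega>) (U \<omega>) - mf_obj \<sigma> \<pi> X (Y \<omega>) u \<ge> ereal (\<kappa> * sq_dist u (U \<omega>))}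
    \<le> measure M {\<omega> \<in> space M.
        (SUP u\<in>{u \<in> cube p. sq_dist u (U \<omega>) > real p * \<epsilon>}.
           ereal (1 / real p) * (mf_obj \<sigma> \<pi> X (Y \<omega>) u - mf_obj \<sigma> \<pi> X (Y \<omega>) (U \<omega>)))
        < ereal (- (\<kappa> * \<epsilon> / 2))}" (is "measure M ?E1 \<le> measure M ?E2")
proof -
  interpret separable_problem p "coupling \<sigma> X" "site_rate \<pi> \<sigma> X" by (rule separable_problem_mf)
  interpret M: prob_space M by (rule M)
  define b where "b \<omega> = site_field \<sigma> X (Y \<omega>)" for \<omega>
  define V where "V \<omega> i = U \<omega> $ i" for \<omega> i
  have Uc: "U \<omega> \<in> carrier_vec p" and V_box: "V \<omega> \<in> unit_box" if "\<omega> \<in> space M" for \<omega>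
    using U that by (auto simp: random_cube_point_def cube_def unit_box_def V_def abs_le_iff)
  have V_meas: "(\<lambda>\<omega>. V \<omega> i) \<in> borel_measurable M" if "i < p" for i
    using U that by (simp add: random_cube_point_def V_def)
  have b_meas: "(\<lambda>\<omega>. b \<omega> i) \<in> borel_measurable M" if "i < p" for i
    unfolding b_def by (rule measurable_site_field[OF X Y that])
  have mf: "mf_obj \<sigma> \<pi> X (Y \<omega>) u = objective (b \<omega>) (\<lambda>i. u $ i)" if "\<omega> \<in> space M" "u \<in> carrier_vec p" for \<omega> u
    unfolding b_def using Y that by (intro mf_obj_eq[OF X _ _ s]) (auto simp: gaussian_vec_def)
  have mfU: "mf_obj \<sigma> \<pi> X (Y \<omega>) (U \<omega>) = objective (b \<omega>) (V \<omega>)" if "\<omega> \<in> space M" for \<omega>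
    using mf[OF that Uc[OF that]] by (simp add: V_def[abs_def])
  have sq: "sq_dist u (U \<omega>) = sqdist (\<lambda>i. u $ i) (V \<omega>)" if "\<omega> \<in> space M" "u \<in> carrier_vec p" for \<omega> u
    using sq_dist_eq[OF that(2) Uc[OF that(1)]] by (simp add: sqdist_def V_def)
  have vec_box: "vec p x \<in> cube p" if "x \<in> unit_box" for x
    using that by (auto simp: cube_def unit_box_def abs_le_iff)
  have objective_vec: "objective c (\<lambda>i. vec p x $ i) = objective c x" for c x by (rule objective_cong) simp
  have sqdist_vec: "sqdist (\<lambda>i. vec p x $ i) y = sqdist x y" for x y by (rule sqdist_cong) simp
  let ?h = "\<lambda>\<omega> x. ereal (1 / real p) * (objective (b \<omega>) x - objective (b \<omega>) (V \<omega>))"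
  have SUP_eq': "(SUP u\<in>{u \<in> cube p. sq_dist u (U \<omega>) > real p * \<epsilon>}.
           ereal (1 / real p) * (mf_obj \<sigma> \<pi> X (Y \<omega>) u - mf_obj \<sigma> \<pi> X (Y \<omega>) (U \<omega>)))
      = (SUP x\<in>{x \<in> unit_box. real p * \<epsilon> < sqdist x (V \<omega>)}. ?h \<omega> x)" if \<omega>: "\<omega> \<in> space M" for \<omega>
  proof (rule SUP_eq)
    fix u assume "u \<in> {u \<in> cube p. sq_dist u (U \<omega>) > real p * \<epsilon>}"
    then have u: "u \<in> cube p" "u \<in> carrier_vec p" "real p * \<epsilon> < sq_dist u (U \<omega>)" by (auto simp: cube_def)
    then show "\<exists>x\<in>{x \<in> unit_box. real p * \<epsilon> < sqdist x (V \<omega>)}.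
        ereal (1 / real p) * (mf_obj \<sigma> \<pi> X (Y \<omega>) u - mf_obj \<sigma> \<pi> X (Y \<omega>) (U \<omega>)) \<le> ?h \<omega> x"
      using sq[OF \<omega> u(2)] mf[OF \<omega> u(2)] mfU[OF \<omega>]
      by (intro bexI[of _ "\<lambda>i. u $ i"]) (auto simp: cube_def unit_box_def abs_le_iff)
  next
    fix x assume "x \<in> {x \<in> unit_box. real p * \<epsilon> < sqdist x (V \<omega>)}"
    then have x: "x \<in> unit_box" "real p * \<epsilon> < sqdist x (V \<omega>)" by auto
    then show "\<exists>u\<in>{u \<in> cube p. sq_dist u (U \<omega>) > real p * \<epsilon>}.
        ?h \<omega> x \<le> ereal (1 / real p) * (mf_obj \<sigma> \<pi> X (Y \<omega>) u - mf_obj \<sigma> \<pi> X (Y \<omega>) (U \<omega>))"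
      using sq[OF \<omega>, of "vec p x"] mf[OF \<omega>, of "vec p x"] mfU[OF \<omega>] vec_box[OF x(1)]
      by (intro bexI[of _ "vec p x"]) (auto simp: objective_vec sqdist_vec)
  qed
  have E2: "?E2 = {\<omega> \<in> space M. (SUP x\<in>{x \<in> unit_box. real p * \<epsilon> < sqdist x (V \<omega>)}. ?h \<omega> x)
      < ereal (- (\<kappa> * \<epsilon> / 2))}" using SUP_eq' by auto
  have "?E2 \<in> sets M"
  proof -
    have "0 < 1 / real p" using p by simp
    from measurable_SUP_far_points[OF b_meas V_meas V_box this, where c = "real p * \<epsilon>"]
    show ?thesis unfolding E2 by (intro borel_measurable_less) auto
  qed
  moreover have "?E1 \<subseteq> ?E2"
    unfolding E2
  proof
    fix \<omega> assume "\<omega> \<in> ?E1"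
    then have \<omega>: "\<omega> \<in> space M" and growth: "\<And>u. u \<in> cube p \<Longrightarrow>
        ereal (\<kappa> * sq_dist u (U \<omega>)) \<le> mf_obj \<sigma> \<pi> X (Y \<omega>) (U \<omega>) - mf_obj \<sigma> \<pi> X (Y \<omega>) u" by auto
    have g: "ereal (\<kappa> * sqdist x (V \<omega>)) \<le> objective (b \<omega>) (V \<omega>) - objective (b \<omega>) x" if "x \<in> unit_box" for x
      using growth[OF vec_box[OF that]] sq[OF \<omega>, of "vec p x"] mf[OF \<omega>, of "vec p x"] mfU[OF \<omega>]
      by (simp add: objective_vec sqdist_vec)
    have "(SUP x\<in>{x \<in> unit_box. real p * \<epsilon> < sqdist x (V \<omega>)}. ?h \<omega> x)
        \<le> ereal (- (1 / real p * (\<kappa> * (real p * \<epsilon>))))"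
      using p by (intro SUP_least quadratic_growth_imp_gap[OF V_box[OF \<omega>] g k]) auto
    also have "\<dots> < ereal (- (\<kappa> * \<epsilon> / 2))" using p k e by simp
    finally show "\<omega> \<in> {\<omega> \<in> space M. (SUP x\<in>{x \<in> unit_box. real p * \<epsilon> < sqdist x (V \<omega>)}. ?h \<omega> x)
      < ereal (- (\<kappa> * \<epsilon> / 2))}" using \<omega> by simp
  qed
  ultimately show ?thesis by (rule M.finite_measure_mono[rotated])
qed

end

theorem lemma5:
  fixes \<sigma> :: real and \<pi> :: "real measure"
    and n :: "nat \<Rightarrow> nat" and X :: "nat \<Rightarrow> real mat" and \<beta>0 :: "nat \<Rightarrow> real vec"
    and \<Omega> :: "nat \<Rightarrow> 'w measure" and Y :: "nat \<Rightarrow> 'w \<Rightarrow> real vec"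
  assumes "\<sigma> > 0"
    and "prob_space \<pi>" and "sets \<pi> = sets borel" and "measure \<pi> {-1..1} = 1"
    and "-1 \<in> msupport \<pi>" and "1 \<in> msupport \<pi>"
    and "filterlim n at_top at_top"
    and "\<And>p. X p \<in> carrier_mat (n p) p"
    and "\<And>p. \<beta>0 p \<in> carrier_vec p"
    and "\<And>p. prob_space (\<Omega> p)"
    and "\<And>p. gaussian_vec (\<Omega> p) (Y p) (n p) (X p *\<^sub>v \<beta>0 p) \<sigma>"
  shows
    "(\<forall>U. (\<forall>p. random_cube_point (\<Omega> p) p (U p)) \<longrightarrow>
        (\<exists>\<kappa>>0. quad_growth \<Omega> \<sigma> \<pi> X Y U \<kappa>) \<longrightarrow> well_separated \<Omega> \<sigma> \<pi> X Y U)
     \<and>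
     (limsup (\<lambda>p. SUP i\<in>{..<p}. ereal (\<Sum>j\<in>{..<p} - {i}. \<bar>off_diag (gram (X p)) $$ (i, j)\<bar>))
          < ereal (\<sigma>\<^sup>2)
      \<or>
      (\<exists>V Z. Z > 0
          \<and> \<pi> = density lborel (\<lambda>x. ennreal (indicator {-1..1} x * (1 / Z * exp (- V x))))
          \<and> (\<forall>x\<in>{-1..1}. V (- x) = V x)
          \<and> mono_on {0..1} V
          \<and> (\<forall>x\<in>{-1<..<1}. V field_differentiable at x)
          \<and> convex_on {0..<1} (deriv V))
        \<and> liminf (\<lambda>p. ereal (lambda_min (gram (X p)))) > 0
      \<longrightarrow>
      (\<exists>U. (\<forall>p. random_cube_point (\<Omega> p) p (U p)) \<and>
         (\<exists>\<kappa>>0. quad_growth \<Omega> \<sigma> \<pi> X Y U \<kappa>)))"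
proof (intro conjI allI impI)
  note s = assms(1) and X = assms(8) and Om = assms(10) and Y = assms(11)
  interpret cube_prior \<pi>
    using assms(2-6) by (simp add: cube_prior_def cube_prior_axioms_def)
  {
    fix U assume U: "\<forall>p. random_cube_point (\<Omega> p) p (U p)" and "\<exists>\<kappa>>0. quad_growth \<Omega> \<sigma> \<pi> X Y U \<kappa>"
    then obtain \<kappa> where k: "\<kappa> > 0" and growth: "quad_growth \<Omega> \<sigma> \<pi> X Y U \<kappa>" by blast
    show "well_separated \<Omega> \<sigma> \<pi> X Y U"
      unfolding well_separated_def
    proof (intro allI impI)
      fix \<epsilon> :: real assume e: "\<epsilon> > 0"
      show "\<exists>\<delta>>0. (\<lambda>p. measure (\<Omega> p) {\<omega> \<in> space (\<Omega> p).
          (SUP u\<in>{u \<in> cube p. sq_dist u (U p \<omega>) > real p * \<epsilon>}.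
             ereal (1 / real p)
               * (mf_obj \<sigma> \<pi> (X p) (Y p \<omega>) u - mf_obj \<sigma> \<pi> (X p) (Y p \<omega>) (U p \<omega>)))
          < ereal (- \<delta>)}) \<longlonglongrightarrow> 1"
      proof (intro exI conjI)
        \<comment> \<open>The supremum is at most \<open>- \<kappa> \<epsilon>\<close>; halving makes the inequality strict.\<close>
        show "\<kappa> * \<epsilon> / 2 > 0" using k e by simp
        show "(\<lambda>p. measure (\<Omega> p) {\<omega> \<in> space (\<Omega> p).
          (SUP u\<in>{u \<in> cube p. sq_dist u (U p \<omega>) > real p * \<epsilon>}.
             ereal (1 / real p)
               * (mf_obj \<sigma> \<pi> (X p) (Y p \<omega>) u - mf_obj \<sigma> \<pi> (X p) (Y p \<omega>) (U p \<omega>)))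
          < ereal (- (\<kappa> * \<epsilon> / 2))}) \<longlonglongrightarrow> 1" (is "?m \<longlonglongrightarrow> 1")
        proof (rule real_tendsto_sandwich)
          show "\<forall>\<^sub>F p in sequentially. measure (\<Omega> p) {\<omega> \<in> space (\<Omega> p). \<forall>u\<in>cube p.
              mf_obj \<sigma> \<pi> (X p) (Y p \<omega>) (U p \<omega>) - mf_obj \<sigma> \<pi> (X p) (Y p \<omega>) u
                \<ge> ereal (\<kappa> * sq_dist u (U p \<omega>))} \<le> ?m p"
            using eventually_gt_at_top[of 0]
          proof eventually_elim
            case (elim p)
            then show ?case
              using separation_event_lower_bound[OF X s Y Om U[rule_format] elim k e] by blast
          qed
          show "\<forall>\<^sub>F p in sequentially. ?m p \<le> 1"
            by (intro always_eventually allI prob_space.prob_le_1[OF Om])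
        qed (use growth in \<open>simp_all add: quad_growth_def\<close>)
      qed
    qed
  }
  {
    assume "limsup (\<lambda>p. SUP i\<in>{..<p}. ereal (\<Sum>j\<in>{..<p} - {i}. \<bar>off_diag (gram (X p)) $$ (i, j)\<bar>))
          < ereal (\<sigma>\<^sup>2)
      \<or>
      (\<exists>V Z. Z > 0
          \<and> \<pi> = density lborel (\<lambda>x. ennreal (indicator {-1..1} x * (1 / Z * exp (- V x))))
          \<and> (\<forall>x\<in>{-1..1}. V (- x) = V x)
          \<and> mono_on {0..1} V
          \<and> (\<forall>x\<in>{-1<..<1}. V field_differentiable at x)
          \<and> convex_on {0..<1} (deriv V))
        \<and> liminf (\<lambda>p. ereal (lambda_min (gram (X p)))) > 0" (is "?A \<or> ?V \<and> ?L")
    then have "\<exists>\<kappa>>0. \<forall>\<^sub>F p in sequentially. \<exists>k.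
        strongly_concave_problem p (coupling \<sigma> (X p)) (site_rate \<pi> \<sigma> (X p)) k \<kappa>"
    proof (elim disjE conjE)
      assume ?A
      then obtain L where L: "limsup (\<lambda>p. SUP i\<in>{..<p}. ereal (\<Sum>j\<in>{..<p} - {i}. \<bar>off_diag (gram (X p)) $$ (i, j)\<bar>)) < ereal L"
          "L < \<sigma>\<^sup>2"
        using ereal_dense2[OF \<open>?A\<close>] by auto
      show ?thesis
      proof (intro exI conjI)
        show "0 < (1 - L / \<sigma>\<^sup>2) / 2" using L(2) s by (simp add: field_simps)
        show "\<forall>\<^sub>F p in sequentially. \<exists>k.
            strongly_concave_problem p (coupling \<sigma> (X p)) (site_rate \<pi> \<sigma> (X p)) k ((1 - L / \<sigma>\<^sup>2) / 2)"
          using Limsup_lessD[OF L(1)]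
        proof eventually_elim
          case (elim p)
          have "(\<Sum>j\<in>{..<p} - {i}. \<bar>off_diag (gram (X p)) $$ (i, j)\<bar>) \<le> L" if "i < p" for i
          proof -
            have "ereal (\<Sum>j\<in>{..<p} - {i}. \<bar>off_diag (gram (X p)) $$ (i, j)\<bar>)
                \<le> (SUP i\<in>{..<p}. ereal (\<Sum>j\<in>{..<p} - {i}. \<bar>off_diag (gram (X p)) $$ (i, j)\<bar>))"
              by (rule SUP_upper) (use that in simp)
            then have "ereal (\<Sum>j\<in>{..<p} - {i}. \<bar>off_diag (gram (X p)) $$ (i, j)\<bar>) < ereal L"
              using elim by (rule le_less_trans)
            then show ?thesis by simp
          qed
          then show ?case using strongly_concave_diagonally_dominant[OF X s L(2)] by blast
        qed
      qed
    next
      assume ?V and ?L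
      obtain V Z where V: "Z > 0"
          "\<pi> = density lborel (\<lambda>x. ennreal (indicator {-1..1} x * (1 / Z * exp (- V x))))"
          "\<And>x. x \<in> {-1..1} \<Longrightarrow> V (- x) = V x" "mono_on {0..1} V"
          "\<And>x. x \<in> {-1<..<1} \<Longrightarrow> V field_differentiable at x" "convex_on {0..<1} (deriv V)"
        using \<open>?V\<close> by blast
      have tilted_var: "d * tilted_var d s \<le> 1" if "0 \<le> d" for d s
        using V that
        by (intro tilted_var_le_inverse[OF V(1,2) _ even_convex_deriv_mono[OF V(3-6)]])
          (auto simp: field_differentiable_derivI)
      obtain l where l: "0 < l" "ereal l < liminf (\<lambda>p. ereal (lambda_min (gram (X p))))"
        using ereal_dense2[OF \<open>?L\<close>] by (auto simp: zero_ereal_def)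
      show ?thesis
      proof (intro exI conjI)
        show "0 < l / \<sigma>\<^sup>2 / 2" using l s by simp
        show "\<forall>\<^sub>F p in sequentially. \<exists>k.
            strongly_concave_problem p (coupling \<sigma> (X p)) (site_rate \<pi> \<sigma> (X p)) k (l / \<sigma>\<^sup>2 / 2)"
          using less_LiminfD[OF l(2)] eventually_gt_at_top[of 0]
        proof eventually_elim
          case (elim p)
          then have "l \<le> lambda_min (gram (X p))" by simp
          then show ?case
            using strongly_concave_log_concave_prior[OF X s elim(2) l(1) _ tilted_var] by blast
        qed
      qed
    qed
    then obtain \<kappa> where k: "\<kappa> > 0" and conc: "\<forall>\<^sub>F p in sequentially. \<exists>k.
        strongly_concave_problem p (coupling \<sigma> (X p)) (site_rate \<pi> \<sigma> (X p)) k \<kappa>" by blast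
    let ?good = "\<lambda>p U. \<forall>\<omega>\<in>space (\<Omega> p). \<forall>u\<in>cube p.
        ereal (\<kappa> * sq_dist u (U \<omega>))
          \<le> mf_obj \<sigma> \<pi> (X p) (Y p \<omega>) (U \<omega>) - mf_obj \<sigma> \<pi> (X p) (Y p \<omega>) u"
    have "\<forall>p. \<exists>U. random_cube_point (\<Omega> p) p U \<and>
        ((\<exists>k. strongly_concave_problem p (coupling \<sigma> (X p)) (site_rate \<pi> \<sigma> (X p)) k \<kappa>) \<longrightarrow> ?good p U)"
    proof
      fix p
      show "\<exists>U. random_cube_point (\<Omega> p) p U \<and>
        ((\<exists>k. strongly_concave_problem p (coupling \<sigma> (X p)) (site_rate \<pi> \<sigma> (X p)) k \<kappa>) \<longrightarrow> ?good p U)"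
      proof (cases "\<exists>k. strongly_concave_problem p (coupling \<sigma> (X p)) (site_rate \<pi> \<sigma> (X p)) k \<kappa>")
        case True
        then show ?thesis using growing_random_maximizer[OF X s Y] by blast
      next
        case False
        \<comment> \<open>This happens for finitely many indices only, which do not affect the limit.\<close>
        have "random_cube_point (\<Omega> p) p (\<lambda>_. 0\<^sub>v p)" by (auto simp: random_cube_point_def cube_def)
        then show ?thesis using False by blast
      qed
    qed
    then obtain U where U: "\<And>p. random_cube_point (\<Omega> p) p (U p)"
      "\<And>p. (\<exists>k. strongly_concave_problem p (coupling \<sigma> (X p)) (site_rate \<pi> \<sigma> (X p)) k \<kappa>) \<Longrightarrow> ?good p (U p)"
      by metis
    have "quad_growth \<Omega> \<sigma> \<pi> X Y U \<kappa>"
      unfolding quad_growth_def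
    proof (rule tendsto_eventually)
      show "\<forall>\<^sub>F p in sequentially. measure (\<Omega> p) {\<omega> \<in> space (\<Omega> p). \<forall>u\<in>cube p.
          mf_obj \<sigma> \<pi> (X p) (Y p \<omega>) (U p \<omega>) - mf_obj \<sigma> \<pi> (X p) (Y p \<omega>) u
            \<ge> ereal (\<kappa> * sq_dist u (U p \<omega>))} = 1"
        using conc
      proof eventually_elim
        case (elim p)
        then have "{\<omega> \<in> space (\<Omega> p). \<forall>u\<in>cube p.
          mf_obj \<sigma> \<pi> (X p) (Y p \<omega>) (U p \<omega>) - mf_obj \<sigma> \<pi> (X p) (Y p \<omega>) u
            \<ge> ereal (\<kappa> * sq_dist u (U p \<omega>))} = space (\<Omega> p)" using U(2)[of p] by blast
        then show ?case using prob_space.prob_space[OF Om] by simp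
      qed
    qed
    then show "\<exists>U. (\<forall>p. random_cube_point (\<Omega> p) p (U p)) \<and> (\<exists>\<kappa>>0. quad_growth \<Omega> \<sigma> \<pi> X Y U \<kappa>)"
      using U(1) k by blast
  }
qed

end
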